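(* Let $1/2<t<1$ and put $\delta:=1-t$. Suppose that there exist positive constants $c_1,c_2,d_1,d_2,c_{\lambda,\nu},l,K$, functions $\nu_i,\lambda_i:\mathbb{N}\to\mathbb{R}_{>0}$ $(i=1,2)$, positive functions $\xi_i,\eta_i$ on the open interval $(1/2,1)$ $(i=1,2)$, positive integers $M,N_0,N_1$ with $N_1<N_0$, and a smooth increasing function $f:\mathbb{R}_{\ge 1}\to\mathbb{R}_{>0}$ such that for any positive integers $n_0\ge N_0$ and $n_1\ge N_1$ the following ten conditions hold: (1) $f(n_0)\ge K f((1+l)n_0)$ and $K\ge (2/3)^{1/2}$; (2) $\displaystyle c_1\frac{\xi_1(t)\nu_1(n_1)}{f(n_1)^{t+\delta t}}\le \sum_{n=1}^{n_1-1}\frac{1}{f(n)^{t+\delta t}}\le c_2\frac{\xi_2(t)\nu_2(n_1)}{f(n_1)^{t+\delta t}}$; (3) $\displaystyle d_1\frac{\eta_1(t)\lambda_1(n_1)}{f(n_1)^{2t}}\le \sum_{n=n_1}^{\infty}\frac{1}{f(n)^{2t}}\le d_2\frac{\eta_2(t)\lambda_2(n_1)}{f(n_1)^{2t}}$; (4) $\lambda_1(n_0)\ge c_{\lambda,\nu}\,\nu_2(n_0)$; (5) $\lambda_2(n_0)\le d_2^{-1}\eta_2(t)^{-1}f(n_0)^{2t}$; (6) $\displaystyle M\ge \max\left\{4^{\frac{1}{1-t}}\left(\frac{c_2\xi_2(t)}{c_{\lambda,\nu}d_1\eta_1(t)}\right)^{\frac{2}{t(1-t)}},\ \left(\frac{50}{K^{t(2-t)}}\right)^{\frac{2}{1-t}}\right\}$;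 (7) $\displaystyle \max_{x\in[n_0,n_0+9M^2]}f'(x)\le \frac{1}{4752}M^{-4}f(n_0)$; (8) $f(n_0+9M^2)\le (264M^2)^{\frac1t}f(n_0)$; (9) $9M f(n_0)^t\le l n_0$; (10) $\displaystyle \nu_1(n_0)\lambda_2(n_0)^{-\frac{1+\delta}{2}}\ge \frac{(d_2\eta_2(t))^{\frac{1+\delta}{2}}}{c_1\xi_1(t)}M^{1-\frac{\delta}{2}}$. Then, for any integer $n_0\ge N_0$, squares of sidelength $f(n)^{-t}$ for $n\ge n_0$ can be packed perfectly into a square of area $\sum_{n=n_0}^{\infty}f(n)^{-2t}$.
   Context: A finite or countably infinite family of squares (or rectangles) in the plane is packed into a region $\Omega$ if they are all contained in $\Omega$ and have pairwise disjoint interiors; it is packed perfectly into $\Omega$ if moreover the family covers $\Omega$ up to a null set. "Squares of sidelength $s_n$ for $n\ge n_0$ can be packed (perfectly) into $\Omega$" means that one can place, for each integer $n\ge n_0$, one square of sidelength $s_n$ so that the resulting family is packed (perfectly) into $\Omega$. "Increasing" means non-decreasing. *)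

theory Defs
  imports "HOL-Analysis.Analysis"
begin

text \<open>The plane is \<open>real \<times> real\<close>, whose library norm is Euclidean.  Squares are closed,
  nondegenerate, and in arbitrary orientation.\<close>

definition planar_square :: "real \<Rightarrow> (real \<times> real) set \<Rightarrow> bool" where
  "planar_square s Q \<longleftrightarrow> 0 < s \<and>
     (\<exists>p u v. norm u = 1 \<and> norm v = 1 \<and> u \<bullet> v = 0 \<and>
        Q = {p + x *\<^sub>R u + y *\<^sub>R v | x y. 0 \<le> x \<and> x \<le> s \<and> 0 \<le> y \<and> y \<le> s})"

definition packed_into :: "'i set \<Rightarrow> ('i \<Rightarrow> (real \<times> real) set) \<Rightarrow> (real \<times> real) set \<Rightarrow> bool" where
  "packed_into I Q \<Omega> \<longleftrightarrow>
     (\<forall>i\<in>I. Q i \<subseteq> \<Omega>) \<and> disjoint_family_on (\<lambda>i. interior (Q i)) I"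

definition perfectly_packed_into :: "'i set \<Rightarrow> ('i \<Rightarrow> (real \<times> real) set) \<Rightarrow> (real \<times> real) set \<Rightarrow> bool" where
  "perfectly_packed_into I Q \<Omega> \<longleftrightarrow>
     packed_into I Q \<Omega> \<and> negligible (\<Omega> - (\<Union>i\<in>I. Q i))"

definition squares_pack_perfectly :: "(nat \<Rightarrow> real) \<Rightarrow> nat \<Rightarrow> (real \<times> real) set \<Rightarrow> bool" where
  "squares_pack_perfectly s n0 \<Omega> \<longleftrightarrow>
     (\<exists>Q. (\<forall>n\<ge>n0. planar_square (s n) (Q n)) \<and> perfectly_packed_into {n0..} Q \<Omega>)"

text \<open>Infinite differentiability on a set; derivatives are taken within the set, hence
  one-sided at the endpoint of a closed half-line.\<close>

definition smooth_on :: "real set \<Rightarrow> (real \<Rightarrow> real) \<Rightarrow> bool" where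
  "smooth_on S f \<longleftrightarrow>
     (\<exists>F :: nat \<Rightarrow> real \<Rightarrow> real. (\<forall>x\<in>S. F 0 x = f x) \<and>
        (\<forall>k. \<forall>x\<in>S. (F k has_real_derivative F (Suc k) x) (at x within S)))"

end

theory Submission imports Defs begin

text \<open>Following Tao, squares are packed greedily into a finite list of rectangles that covers the
  uncovered part of the big square.  A rectangle with sides \<open>w \<ge> h\<close> has weight \<open>w h\<^sup>\<delta>\<close>, and the total
  weight is kept below \<open>M powr (\<delta> / 2 - 1)\<close> times the sum of \<open>s i powr (1 + \<delta>)\<close> over \<open>i < n\<close>.
  Since the total area is the tail sum of squares, this bound forces some rectangle to have both
  sides at least \<open>M s n\<close>.  A strip of height \<open>M s n\<close> along its long side is cut into blocks of about
  \<open>M \<times> M\<close> squares.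

  Inside a block, keeping the squares in aligned rows and columns would leave a long sliver at each
  square, which is too heavy when \<open>\<delta>\<close> is small.  Instead each row is shifted against the one below, so
  that horizontal and vertical neighbours touch and the only gap at an inner vertex is a pinwheel hole
  both of whose sides are differences of square sizes.  The waste at the boundary of the block is of
  order \<open>M\<close> unit weights, a fraction of order \<open>1 / M\<close> of the weight of the squares placed, and is
  absorbed by the factor \<open>M powr (\<delta> / 2) \<ge> 50\<close>.\<close>

section \<open>Rectangles and partial packings\<close>

type_synonym rect = "real \<times> real \<times> real \<times> real"

fun rset :: "rect \<Rightarrow> (real \<times> real) set" where
  "rset (a, b, c, d) = {a..b} \<times> {c..d}"

fun rarea :: "rect \<Rightarrow> real" where
  "rarea (a, b, c, d) = (b - a) * (d - c)"

fun rvalid :: "rect \<Rightarrow> bool" where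
  "rvalid (a, b, c, d) \<longleftrightarrow> a \<le> b \<and> c \<le> d"

fun rswap :: "rect \<Rightarrow> rect" where
  "rswap (a, b, c, d) = (c, d, a, b)"

text \<open>Area equals weight times the short side to the power 1 - \<delta>. Hence a small total
  weight together with a given total area forces a rectangle that is not thin. Degenerate rectangles
  have weight 0.\<close>

fun weight :: "real \<Rightarrow> rect \<Rightarrow> real" where
  "weight \<delta> (a, b, c, d) = max (b - a) (d - c) * min (b - a) (d - c) powr \<delta>"

definition cover :: "rect list \<Rightarrow> (real \<times> real) set" where
  "cover L = (\<Union>R\<in>set L. rset R)"

definition total_area :: "rect list \<Rightarrow> real" where
  "total_area L = sum_list (map rarea L)"

definition total_weight :: "real \<Rightarrow> rect list \<Rightarrow> real" where
  "total_weight \<delta> L = sum_list (map (weight \<delta>) L)"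

definition sq :: "real \<times> real \<Rightarrow> real \<Rightarrow> rect" where
  "sq p s = (fst p, fst p + s, snd p, snd p + s)"

text \<open>Disjointness of interiors is not required here: it follows from the covering and the balance of
  areas, see \<open>packs_negligible_Int\<close> below.\<close>

definition packs :: "(nat \<Rightarrow> real) \<Rightarrow> (nat \<Rightarrow> real \<times> real) \<Rightarrow> nat \<Rightarrow> rect list \<Rightarrow> nat \<Rightarrow> rect list \<Rightarrow> bool" where
  "packs s c n X n' L \<longleftrightarrow> n \<le> n' \<and> (\<forall>R\<in>set L. rvalid R) \<and> cover L \<subseteq> cover X \<and>
     (\<Sum>m\<in>{n..<n'}. (s m)\<^sup>2) + total_area L = total_area X \<and>
     (\<forall>m\<in>{n..<n'}. rset (sq (c m) (s m)) \<subseteq> cover X) \<and>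
     cover X \<subseteq> (\<Union>m\<in>{n..<n'}. rset (sq (c m) (s m))) \<union> cover L"

section \<open>Composing, framing and reflecting partial packings\<close>

lemma cover_simps [simp]:
  "cover [] = {}" "cover (R # L) = rset R \<union> cover L" "cover (L @ L') = cover L \<union> cover L'"
  by (auto simp: cover_def)

lemma total_area_simps [simp]:
  "total_area [] = 0" "total_area (R # L) = rarea R + total_area L"
  "total_area (L @ L') = total_area L + total_area L'"
  by (auto simp: total_area_def)

lemma total_weight_simps [simp]:
  "total_weight \<delta> [] = 0" "total_weight \<delta> (R # L) = weight \<delta> R + total_weight \<delta> L"
  "total_weight \<delta> (L @ L') = total_weight \<delta> L + total_weight \<delta> L'"
  by (auto simp: total_weight_def)

lemma packs_trans:
  assumes "packs s c n X n1 Y" "packs s c n1 Y n2 L"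
  shows "packs s c n X n2 L"
proof -
  have le: "n \<le> n1" "n1 \<le> n2" using assms by (auto simp: packs_def)
  have un: "{n..<n2} = {n..<n1} \<union> {n1..<n2}" using le by auto
  have sum: "(\<Sum>m\<in>{n..<n2}. (s m)\<^sup>2) = (\<Sum>m\<in>{n..<n1}. (s m)\<^sup>2) + (\<Sum>m\<in>{n1..<n2}. (s m)\<^sup>2)"
    using le by (simp add: sum.atLeastLessThan_concat)
  show ?thesis
    unfolding packs_def sum
    apply (intro conjI)
    subgoal using le by simp
    subgoal using assms by (auto simp: packs_def)
    subgoal using assms unfolding packs_def by blast
    subgoal using assms by (auto simp: packs_def)
    subgoal using assms unfolding packs_def un by blast
    subgoal using assms unfolding packs_def un by blast
    done
qed

text \<open>The rectangles of \<open>Y\<close> are carried along untouched. They may overlap those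
  of \<open>X\<close>: areas are counted with multiplicity, and the other clauses only concern
  unions.\<close>

lemma packs_frame:
  assumes "packs s c n X n' L" "\<forall>R\<in>set Y. rvalid R"
  shows "packs s c n (X @ Y) n' (L @ Y)"
  using assms unfolding packs_def by (auto 0 3)

lemma packs_perm:
  assumes "packs s c n X n' L" "mset X = mset X'" "mset L = mset L'"
  shows "packs s c n X' n' L'"
proof -
  have "set X = set X'" "set L = set L'" using assms(2,3) mset_eq_setD by blast+
  moreover have "total_area X = total_area X'" "total_area L = total_area L'"
    unfolding total_area_def using assms(2,3) by (metis mset_map sum_mset_sum_list)+
  ultimately show ?thesis using assms(1) unfolding packs_def cover_def by simp
qed

lemma packs_cong:
  assumes "packs s c n X n' L" "\<And>m. n \<le> m \<Longrightarrow> m < n' \<Longrightarrow> c m = c' m"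
  shows "packs s c' n X n' L"
  using assms unfolding packs_def by simp

text \<open>The two position maps are glued at the index \<open>n1\<close>, since
  \<open>packs\<close> only looks at positions of the indices it places.\<close>

lemma packs_trans_ex:
  assumes "\<exists>c. packs s c n X n1 Y" "\<exists>c. packs s c n1 Y n2 L"
  shows "\<exists>c. packs s c n X n2 L"
proof -
  obtain c1 c2 where c: "packs s c1 n X n1 Y" "packs s c2 n1 Y n2 L" using assms by blast
  let ?c = "\<lambda>m. if m < n1 then c1 m else c2 m"
  have "packs s ?c n X n1 Y" "packs s ?c n1 Y n2 L"
    using packs_cong[OF c(1), of ?c] packs_cong[OF c(2), of ?c] by auto
  then show ?thesis using packs_trans by blast
qed

lemma packs_split_x:
  assumes "a \<le> x" "x \<le> b" "p \<le> q"
  shows "packs s c n [(a, b, p, q)] n [(a, x, p, q), (x, b, p, q)]"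
  using assms unfolding packs_def by (auto simp: algebra_simps)

lemma packs_split_y:
  assumes "a \<le> b" "p \<le> y" "y \<le> q"
  shows "packs s c n [(a, b, p, q)] n [(a, b, p, y), (a, b, y, q)]"
  using assms unfolding packs_def by (auto simp: algebra_simps)

lemma rset_rswap: "rset (rswap R) = prod.swap ` rset R"
  by (cases R) (auto simp: image_iff)

text \<open>Reflection in the diagonal. Thanks to it, strips need only be cut from rectangles that
  are at least as wide as high.\<close>

lemma packs_rswap:
  assumes "packs s c n X n' L"
  shows "packs s (prod.swap \<circ> c) n (map rswap X) n' (map rswap L)"
proof -
  have cov: "cover (map rswap Z) = prod.swap ` cover Z" for Z
    by (simp add: cover_def rset_rswap image_UN)
  have area: "rarea (rswap R) = rarea R" for R by (cases R) simp
  have tot: "total_area (map rswap Z) = total_area Z" for Z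
    by (simp add: total_area_def comp_def area)
  have sqs: "rset (sq ((prod.swap \<circ> c) m) (s m)) = prod.swap ` rset (sq (c m) (s m))" for m
    by (subst rset_rswap[symmetric]) (simp add: sq_def)
  have valid: "rvalid (rswap R) = rvalid R" for R by (cases R) auto
  show ?thesis
    using assms unfolding packs_def cov tot sqs
    by (simp add: valid) (blast intro: image_mono)
qed

lemma weight_rswap: "weight \<delta> (rswap R) = weight \<delta> R"
  by (cases R) (simp add: max.commute min.commute)

lemma total_weight_rswap: "total_weight \<delta> (map rswap L) = total_weight \<delta> L"
  by (simp add: total_weight_def comp_def weight_rswap)

lemma weight_nonneg: "rvalid R \<Longrightarrow> 0 \<le> weight \<delta> R"
  by (cases R) (auto simp: max_def)

text \<open>There is no need to know which side is the longer one: as \<open>v \<le> u\<close>,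
  either alternative bounds the maximum by \<open>u\<close> and the minimum by
  \<open>v\<close>.\<close>

lemma weight_le:
  assumes "rvalid (a, b, p, q)" "0 \<le> \<delta>" "v \<le> u" "b - a \<le> u \<and> q - p \<le> v \<or> b - a \<le> v \<and> q - p \<le> u"
  shows "weight \<delta> (a, b, p, q) \<le> u * v powr \<delta>"
proof -
  have "max (b - a) (q - p) \<le> u" "min (b - a) (q - p) \<le> v" using assms by (auto simp: min_def)
  moreover have "0 \<le> min (b - a) (q - p)" using assms by auto
  ultimately show ?thesis using assms unfolding weight.simps
    by (intro mult_mono powr_mono2) auto
qed

section \<open>Measure of covers and almost disjointness\<close>

lemma measurable_rset: "rset R \<in> lmeasurable"
  and measure_rset: "rvalid R \<Longrightarrow> measure lebesgue (rset R) = rarea R"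
proof -
  obtain a b p q where R: "R = (a, b, p, q)" by (cases R) auto
  have eq: "rset R = cbox (a, p) (b, q)" by (simp add: R cbox_Pair_eq)
  show "rset R \<in> lmeasurable" unfolding eq by simp
  show "rvalid R \<Longrightarrow> measure lebesgue (rset R) = rarea R"
    unfolding eq by (simp add: content_Pair R)
qed

lemma measurable_cover: "cover L \<in> lmeasurable"
  by (induction L) (auto simp: measurable_rset fmeasurable.Un)

lemma measure_cover_le: "\<forall>R\<in>set L. rvalid R \<Longrightarrow> measure lebesgue (cover L) \<le> total_area L"
proof (induction L)
  case (Cons R L)
  have "measure lebesgue (rset R \<union> cover L) \<le> measure lebesgue (rset R) + measure lebesgue (cover L)"
    by (intro measure_Un_le) (use measurable_rset measurable_cover in \<open>auto simp: fmeasurable_def\<close>)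
  then show ?case using Cons by (simp add: measure_rset)
qed simp

text \<open>Inclusion-exclusion for the pair \<open>A i\<close>, \<open>A j\<close> and
  subadditivity for the remaining sets show that the overlap of the pair is lost in the measure of
  the union; the hypothesis on the sum leaves no room for a loss.\<close>

lemma negligible_Int_of_measure_Union:
  fixes A :: "'i \<Rightarrow> 'a::euclidean_space set"
  assumes "finite I" "\<And>i. i \<in> I \<Longrightarrow> A i \<in> lmeasurable"
    and "(\<Sum>i\<in>I. measure lebesgue (A i)) \<le> measure lebesgue (\<Union>i\<in>I. A i)"
    and "i \<in> I" "j \<in> I" "i \<noteq> j"
  shows "negligible (A i \<inter> A j)"
proof -
  let ?\<mu> = "measure lebesgue" and ?J = "I - {i, j}"
  have fin: "finite ?J" using assms(1) by simp
  have J: "(\<Union>i\<in>?J. A i) \<in> lmeasurable" using fin assms(2) by (intro fmeasurable.finite_UN) auto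
  have m: "A i \<in> lmeasurable" "A j \<in> lmeasurable" using assms by auto
  have "(\<Union>i\<in>I. A i) = (A i \<union> A j) \<union> (\<Union>i\<in>?J. A i)" using assms by auto
  then have "?\<mu> (\<Union>i\<in>I. A i) \<le> ?\<mu> (A i \<union> A j) + ?\<mu> (\<Union>i\<in>?J. A i)"
    using m J by (metis (no_types, lifting) fmeasurableD fmeasurable.Un measure_Un_le)
  also have "?\<mu> (\<Union>i\<in>?J. A i) \<le> (\<Sum>i\<in>?J. ?\<mu> (A i))"
    using fin assms(2) by (intro measure_UNION_le) auto
  also have "?\<mu> (A i \<union> A j) = ?\<mu> (A i) + ?\<mu> (A j) - ?\<mu> (A i \<inter> A j)"
    using m by (simp add: measure_Un3)
  also have "(\<Sum>i\<in>?J. ?\<mu> (A i)) = (\<Sum>i\<in>I. ?\<mu> (A i)) - ?\<mu> (A i) - ?\<mu> (A j)"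
  proof -
    have "I = insert i (insert j ?J)" using assms by auto
    then have "(\<Sum>i\<in>I. ?\<mu> (A i)) = (\<Sum>i\<in>insert i (insert j ?J). ?\<mu> (A i))" by simp
    then show ?thesis using assms(6) fin by simp
  qed
  finally have "?\<mu> (A i \<inter> A j) \<le> 0" using assms(3) by linarith
  moreover have "A i \<inter> A j \<in> lmeasurable" using m by (intro fmeasurable.Int)
  ultimately show ?thesis
    by (simp add: negligible_iff_measure measure_le_0_iff)
qed

text \<open>The squares and \<open>cover L\<close> together cover \<open>R\<close>, and their areas
  sum to exactly the area of \<open>R\<close>. So the union of the squares measures at least the sum
  of their areas.\<close>

lemma packs_negligible_Int:
  assumes "packs s c n [R] n' L" "rvalid R" "\<And>m. m \<in> {n..<n'} \<Longrightarrow> 0 \<le> s m"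
    and "i \<in> {n..<n'}" "j \<in> {n..<n'}" "i \<noteq> j"
  shows "negligible (rset (sq (c i) (s i)) \<inter> rset (sq (c j) (s j)))"
proof -
  let ?A = "\<lambda>m. rset (sq (c m) (s m))" and ?I = "{n..<n'}"
  have meas: "measure lebesgue (?A m) = (s m)\<^sup>2" if "m \<in> ?I" for m
    using assms(3)[OF that] by (subst measure_rset) (auto simp: sq_def power2_eq_square)
  have UM: "(\<Union>m\<in>?I. ?A m) \<in> lmeasurable" by (intro fmeasurable.finite_UN) (auto simp: measurable_rset)
  have "rarea R = measure lebesgue (rset R)" using assms(2) by (simp add: measure_rset)
  also have "\<dots> \<le> measure lebesgue ((\<Union>m\<in>?I. ?A m) \<union> cover L)"
    using assms(1) UM measurable_cover measurable_rset
    by (intro measure_mono_fmeasurable) (auto simp: packs_def fmeasurable.Un fmeasurableD)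
  also have "\<dots> \<le> measure lebesgue (\<Union>m\<in>?I. ?A m) + measure lebesgue (cover L)"
    using UM measurable_cover by (intro measure_Un_le) auto
  also have "measure lebesgue (cover L) \<le> total_area L"
    using assms(1) by (intro measure_cover_le) (auto simp: packs_def)
  finally have "(\<Sum>m\<in>?I. measure lebesgue (?A m)) \<le> measure lebesgue (\<Union>m\<in>?I. ?A m)"
    using assms(1) by (simp add: packs_def meas)
  then show ?thesis
    using assms(4-6) by (intro negligible_Int_of_measure_Union[where I="?I" and A="?A"]) (auto simp: measurable_rset)
qed

section \<open>Staircases\<close>

text \<open>The region above a staircase and below the height \<open>H\<close>, cut into vertical
  columns.\<close>

definition stair :: "nat \<Rightarrow> (nat \<Rightarrow> real) \<Rightarrow> (nat \<Rightarrow> real) \<Rightarrow> real \<Rightarrow> rect list" where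
  "stair N x y H = map (\<lambda>i. (x i, x (Suc i), y i, H)) [0..<N]"

lemma sum_list_map_upt: "sum_list (map f [a..<b]) = sum f {a..<b}"
  for f :: "nat \<Rightarrow> real"
  by (simp add: interv_sum_list_conv_sum_set_nat)

lemma cover_stair: "p \<in> cover (stair N x y H) \<longleftrightarrow>
   (\<exists>i<N. x i \<le> fst p \<and> fst p \<le> x (Suc i) \<and> y i \<le> snd p \<and> snd p \<le> H)"
  by (cases p) (auto simp: cover_def stair_def)

lemma total_area_stair: "total_area (stair N x y H) = (\<Sum>i<N. (x (Suc i) - x i) * (H - y i))"
  by (simp add: total_area_def stair_def comp_def sum_list_map_upt atLeast0LessThan)

text \<open>Abel summation; \<open>e 0 = 0\<close> removes the boundary term on the left.\<close>

lemma sum_by_parts: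
  fixes e u :: "nat \<Rightarrow> real"
  assumes "e 0 = 0"
  shows "(\<Sum>i<Suc k. (e (Suc i) - e i) * u i) =
         e (Suc k) * u k - (\<Sum>i\<in>{1..<Suc k}. e i * (u i - u (i - 1)))"
  by (induction k) (use assms in \<open>simp_all add: algebra_simps\<close>)

text \<open>Raising the steps by \<open>b\<close> over the new abscissae \<open>z\<close> costs the
  squares and the gap left of the first square; moving the abscissae from \<open>x\<close> to
  \<open>z\<close> costs the holes, by summation by parts. As \<open>z 0 = x 0\<close>, the first
  new column also runs above the left gap.\<close>

lemma stair_area_step:
  fixes x x' z y b :: "nat \<Rightarrow> real"
  assumes N: "0 < N" and x'_Suc: "\<And>i. i < N \<Longrightarrow> x' (Suc i) = x' i + b i" and x'_N: "x' N = x N"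
    and z: "z 0 = x 0" "\<And>i. 0 < i \<Longrightarrow> z i = x' i"
  shows "(\<Sum>i<N. (b i)\<^sup>2) + (\<Sum>i\<in>{1..<N}. (x' i - x i) * (y (i - 1) - y i)) + (x' 0 - x 0) * b 0 +
           (\<Sum>i<N. (z (Suc i) - z i) * (H - (y i + b i))) = (\<Sum>i<N. (x (Suc i) - x i) * (H - y i))"
proof -
  obtain k where k: "N = Suc k" using N by (cases N) auto
  have step: "(z (Suc i) - z i) * b i = (b i)\<^sup>2 + (if i = 0 then (x' 0 - x 0) * b 0 else 0)" if "i < N" for i
    using x'_Suc[OF that] z by (cases i) (simp_all add: power2_eq_square algebra_simps)
  have "(\<Sum>i<N. (z (Suc i) - z i) * b i) = (\<Sum>i<N. (b i)\<^sup>2 + (if i = 0 then (x' 0 - x 0) * b 0 else 0))"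
    by (intro sum.cong refl step) simp
  also have "\<dots> = (\<Sum>i<N. (b i)\<^sup>2) + (x' 0 - x 0) * b 0"
    using N by (simp add: sum.distrib)
  finally have 1: "(\<Sum>i<N. (z (Suc i) - z i) * b i) = (\<Sum>i<N. (b i)\<^sup>2) + (x' 0 - x 0) * b 0" .
  let ?e = "\<lambda>i. z i - x i" and ?u = "\<lambda>i. H - y i"
  have "(\<Sum>i<Suc k. (?e (Suc i) - ?e i) * ?u i) =
      ?e (Suc k) * ?u k - (\<Sum>i\<in>{1..<Suc k}. ?e i * (?u i - ?u (i - 1)))"
    by (rule sum_by_parts) (simp add: z)
  moreover have "?e (Suc k) = 0" using x'_N z(2)[of N] k by simp
  moreover have "(\<Sum>i\<in>{1..<Suc k}. ?e i * (?u i - ?u (i - 1))) =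
      (\<Sum>i\<in>{1..<N}. (x' i - x i) * (y (i - 1) - y i))"
    unfolding k by (intro sum.cong) (auto simp: z)
  ultimately have 2: "(\<Sum>i<N. (?e (Suc i) - ?e i) * ?u i) =
      - (\<Sum>i\<in>{1..<N}. (x' i - x i) * (y (i - 1) - y i))"
    using k by simp
  have "(\<Sum>i<N. (z (Suc i) - z i) * (H - (y i + b i))) =
      (\<Sum>i<N. (?e (Suc i) - ?e i) * ?u i) + (\<Sum>i<N. (x (Suc i) - x i) * (H - y i)) -
      (\<Sum>i<N. (z (Suc i) - z i) * b i)"
    unfolding sum.distrib[symmetric] sum_subtractf[symmetric] by (intro sum.cong) (auto simp: algebra_simps)
  then show ?thesis using 1 2 by linarith
qed

text \<open>Each square of the new row overhangs the lower right neighbour of the square below it;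
  the space under the overhang is a hole.\<close>

definition row_waste :: "nat \<Rightarrow> (nat \<Rightarrow> real) \<Rightarrow> (nat \<Rightarrow> real) \<Rightarrow> (nat \<Rightarrow> real) \<Rightarrow> real \<Rightarrow> rect list" where
  "row_waste N x x' y b = map (\<lambda>i. (x i, x' i, y i, y (i - 1))) [1..<N] @ [(x 0, x' 0, y 0, y 0 + b)]"

text \<open>Square \<open>i\<close> of the row stands on step \<open>i\<close> but is shifted to the
  right by at most the width of that column. As the steps descend to the right, it overhangs step
  \<open>Suc i\<close> without colliding with it.\<close>

lemma packs_row:
  fixes x x' z y y' s :: "nat \<Rightarrow> real"
  assumes N: "0 < N" and x'_Suc: "\<And>i. i < N \<Longrightarrow> x' (Suc i) = x' i + s (n + i)" and x'_N: "x' N = x N"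
    and z: "z 0 = x 0" "\<And>i. 0 < i \<Longrightarrow> z i = x' i"
    and y': "\<And>i. i < N \<Longrightarrow> y' i = y i + s (n + i)"
    and x'_ge: "\<And>i. i < N \<Longrightarrow> x i \<le> x' i" and x'_le: "\<And>i. i < N \<Longrightarrow> x' i \<le> x (Suc i)"
    and y: "\<And>i. Suc i < N \<Longrightarrow> y (Suc i) \<le> y i"
    and s: "\<And>i. i < N \<Longrightarrow> 0 \<le> s (n + i)" and H: "\<And>i. i < N \<Longrightarrow> y' i \<le> H"
  shows "\<exists>c. packs s c n (stair N x y H) (n + N) (row_waste N x x' y (s n) @ stair N z y' H)"
proof -
  define c where "c = (\<lambda>m. (x' (m - n), y (m - n)))"
  have c: "rset (sq (c (n + i)) (s (n + i))) = {x' i..x' (Suc i)} \<times> {y i..y' i}" if "i < N" for i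
    using x'_Suc[OF that] y'[OF that] by (simp add: c_def sq_def)
  have range: "{n..<n + N} = (\<lambda>i. n + i) ` {..<N}"
    using image_add_atLeastLessThan[of n 0 N] by (simp add: lessThan_atLeast0 add.commute)
  have le: "y i \<le> y' i" "x' i \<le> x' (Suc i)" "y i \<le> H" if "i < N" for i
    using s[OF that] y'[OF that] x'_Suc[OF that] H[OF that] by auto
  have x'_le2: "x' (Suc i) \<le> x (Suc (Suc i))" if "Suc i < N" for i using x'_le that by blast
  have z_mono: "z i \<le> z (Suc i)" if "i < N" for i
    using z le(2)[OF that] x'_ge[OF that] by (cases i) auto
  have z_ge: "x i \<le> z i" if "i < N" for i using z x'_ge[OF that] by (cases i) auto
  have valid: "\<forall>R\<in>set (row_waste N x x' y (s n) @ stair N z y' H). rvalid R"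
  proof -
    have "y i \<le> y (i - 1)" if "i \<in> {1..<N}" for i using y[of "i - 1"] that by auto
    then show ?thesis using x'_ge N s[OF N] z_mono H by (auto simp: row_waste_def stair_def)
  qed
  \<comment> \<open>A point beyond the right end of column \<open>i\<close> lies in column
    \<open>Suc i\<close>, whose step is no higher. The last column has no overhang, because
    \<open>x' N = x N\<close>.\<close>
  have column: "p \<in> cover (stair N x y H)"
    if "i < N" "x i \<le> fst p" "fst p \<le> x' (Suc i)" "y i \<le> snd p" "snd p \<le> H" for p i
  proof (cases "fst p \<le> x (Suc i)")
    case True
    then show ?thesis using that cover_stair by blast
  next
    case False
    then have "Suc i < N" using that(1,3) x'_N by (metis Suc_lessI)
    then have "fst p \<le> x (Suc (Suc i))" "y (Suc i) \<le> snd p" using x'_le2[of i] y[of i] that by auto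
    then show ?thesis using False \<open>Suc i < N\<close> that(5) by (subst cover_stair) (auto intro!: exI[of _ "Suc i"])
  qed
  have sq_in: "rset (sq (c (n + i)) (s (n + i))) \<subseteq> cover (stair N x y H)" if "i < N" for i
    unfolding c[OF that] using x'_ge[OF that] H[OF that] that by (auto intro!: column[OF that])
  have row_in: "cover (stair N z y' H) \<subseteq> cover (stair N x y H)"
  proof
    fix p assume "p \<in> cover (stair N z y' H)"
    then obtain i where i: "i < N" "z i \<le> fst p" "fst p \<le> z (Suc i)" "y' i \<le> snd p" "snd p \<le> H"
      unfolding cover_stair by blast
    then show "p \<in> cover (stair N x y H)"
      using z_ge[of i] le(1)[of i] z(2)[of "Suc i"] by (intro column[of i]) auto
  qed
  have waste_in: "cover (row_waste N x x' y (s n)) \<subseteq> cover (stair N x y H)"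
  proof
    fix p assume "p \<in> cover (row_waste N x x' y (s n))"
    then consider i where "i \<in> {1..<N}" "p \<in> rset (x i, x' i, y i, y (i - 1))"
      | "p \<in> rset (x 0, x' 0, y 0, y 0 + s n)"
      unfolding cover_def row_waste_def by auto
    then show "p \<in> cover (stair N x y H)"
    proof cases
      case 1
      then have "i < N" "y (i - 1) \<le> H" using le(3)[of "i - 1"] by auto
      then show ?thesis using 1 le(2)[of i] by (intro column[of i]) auto
    next
      case 2
      then show ?thesis using N le(2)[of 0] H[OF N] y'[OF N] by (intro column[of 0]) auto
    qed
  qed
  have area: "(\<Sum>m\<in>{n..<n + N}. (s m)\<^sup>2) + total_area (row_waste N x x' y (s n) @ stair N z y' H)
      = total_area (stair N x y H)"
  proof -
    have "(\<Sum>m\<in>{n..<n + N}. (s m)\<^sup>2) = (\<Sum>i<N. (s (n + i))\<^sup>2)"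
      unfolding range by (subst sum.reindex) auto
    moreover have "total_area (row_waste N x x' y (s n)) =
       (\<Sum>i\<in>{1..<N}. (x' i - x i) * (y (i - 1) - y i)) + (x' 0 - x 0) * s (n + 0)"
      by (simp add: row_waste_def) (simp add: total_area_def comp_def sum_list_map_upt)
    moreover have "total_area (stair N z y' H) = (\<Sum>i<N. (z (Suc i) - z i) * (H - (y i + s (n + i))))"
      unfolding total_area_stair by (intro sum.cong) (auto simp: y')
    ultimately show ?thesis
      using stair_area_step[where b = "\<lambda>i. s (n + i)" and N = N and x = x and x' = x' and z = z and y = y and H = H,
          OF N x'_Suc x'_N z]
      by (simp add: total_area_stair)
  qed
  have covered: "cover (stair N x y H) \<subseteq> (\<Union>m\<in>{n..<n + N}. rset (sq (c m) (s m))) \<union>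
      cover (row_waste N x x' y (s n) @ stair N z y' H)" (is "_ \<subseteq> ?S \<union> _")
  proof
    fix p assume "p \<in> cover (stair N x y H)"
    then obtain i where i: "i < N" "x i \<le> fst p" "fst p \<le> x (Suc i)" "y i \<le> snd p" "snd p \<le> H"
      unfolding cover_stair by blast
    have in_new: "p \<in> ?S \<union> cover (stair N z y' H)"
      if "k < N" "x' k \<le> fst p" "fst p \<le> x' (Suc k)" "y k \<le> snd p" for k
    proof (cases "snd p \<le> y' k")
      case True
      then have "p \<in> rset (sq (c (n + k)) (s (n + k)))" unfolding c[OF that(1)] using that by (cases p) auto
      then show ?thesis unfolding range using that(1) by blast
    next
      case False
      have "z k \<le> x' k" using z x'_ge[OF N] by (cases k) auto
      then have "p \<in> cover (stair N z y' H)" unfolding cover_stair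
        using False that i z(2)[of "Suc k"] by (intro exI[of _ k]) auto
      then show ?thesis by blast
    qed
    \<comment> \<open>Left of \<open>x' i\<close>, the point lies in the hole below
      \<open>y (i - 1)\<close>, or in or above the overhanging square \<open>i - 1\<close>; for
      \<open>i = 0\<close> it lies in the left gap or above it.\<close>
    show "p \<in> ?S \<union> cover (row_waste N x x' y (s n) @ stair N z y' H)"
    proof (cases "x' i \<le> fst p")
      case True
      have "x (Suc i) \<le> x' (Suc i)" using x'_ge[of "Suc i"] x'_N i(1) by (metis Suc_lessI order_refl)
      then have "fst p \<le> x' (Suc i)" using i by linarith
      then show ?thesis using in_new[of i] True i by auto
    next
      case left: False
      show ?thesis
      proof (cases i)
        case 0
        show ?thesis
        proof (cases "snd p \<le> y' 0")
          case True
          then have "p \<in> rset (x 0, x' 0, y 0, y 0 + s n)" using left i 0 y'[OF N] by (cases p) auto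
          then show ?thesis by (auto simp: row_waste_def)
        next
          case False
          then have "p \<in> cover (stair N z y' H)" unfolding cover_stair
            using left i 0 z le(2)[OF N] N by (intro exI[of _ 0]) auto
          then show ?thesis by auto
        qed
      next
        case (Suc k)
        show ?thesis
        proof (cases "snd p \<le> y k")
          case True
          then have "p \<in> rset (x i, x' i, y i, y (i - 1))" using left i Suc by (cases p) auto
          moreover have "i \<in> {1..<N}" using Suc i by auto
          ultimately show ?thesis unfolding row_waste_def cover_def by auto
        next
          case False
          then show ?thesis using in_new[of k] left i Suc x'_le[of k] by auto
        qed
      qed
    qed
  qed
  have "packs s c n (stair N x y H) (n + N) (row_waste N x x' y (s n) @ stair N z y' H)"
    unfolding packs_def
    using valid row_in waste_in area covered sq_in range by auto
  then show ?thesis by blast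
qed

section \<open>Blocks of nearly equal squares\<close>

lemma packs_columns:
  assumes "0 < N" "\<And>i. i < N \<Longrightarrow> x i \<le> x (Suc i)" "p \<le> q"
  shows "packs s c n [(x 0, x N, p, q)] n (stair N x (\<lambda>_. p) q)"
  using assms(1,2)
proof (induction N rule: nat_induct_non_zero)
  case 1
  then show ?case using assms(3) by (auto simp: packs_def stair_def)
next
  case (Suc N)
  have "x 0 \<le> x k" if "k \<le> N" for k
    using that Suc.prems by (induction k) (auto intro: order_trans)
  then have "packs s c n [(x 0, x (Suc N), p, q)] n ([(x 0, x N, p, q)] @ [(x N, x (Suc N), p, q)])"
    using packs_split_x[of "x 0" "x N" "x (Suc N)" p q s c n] Suc.prems assms(3) by simp
  also have "packs s c n ([(x 0, x N, p, q)] @ [(x N, x (Suc N), p, q)]) n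
      (stair N x (\<lambda>_. p) q @ [(x N, x (Suc N), p, q)])"
    using Suc assms(3) by (intro packs_frame) auto
  also (packs_trans) have "stair N x (\<lambda>_. p) q @ [(x N, x (Suc N), p, q)] = stair (Suc N) x (\<lambda>_. p) q"
    by (simp add: stair_def)
  finally show ?case .
qed

lemma total_weight_le_length:
  assumes "\<And>R. R \<in> set L \<Longrightarrow> weight \<delta> R \<le> u"
  shows "total_weight \<delta> L \<le> real (length L) * u"
  using assms
proof (induction L)
  case (Cons R L)
  have "weight \<delta> R \<le> u" "total_weight \<delta> L \<le> real (length L) * u" using Cons by auto
  then show ?case by (simp add: distrib_right)
qed simp

text \<open>\<open>s_close\<close> serves a single block, which has at most
  \<open>9 * M\<^sup>2\<close> squares. \<open>s_slow\<close> serves a whole strip, over which the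
  sizes may drop by a factor 2. \<open>M_large\<close> makes the allowance exceed the waste.\<close>

locale slowly_varying =
  fixes s :: "nat \<Rightarrow> real" and M N0 :: nat and \<delta> :: real
  assumes M_pos: "0 < M" and N0_pos: "0 < N0" and \<delta>: "0 < \<delta>" "\<delta> < 1"
    and s_pos: "\<And>n. 1 \<le> n \<Longrightarrow> 0 < s n"
    and s_antimono: "\<And>m n. 1 \<le> m \<Longrightarrow> m \<le> n \<Longrightarrow> s n \<le> s m"
    and s_close: "\<And>n k. N0 \<le> n \<Longrightarrow> k \<le> 9 * M\<^sup>2 \<Longrightarrow> s n - s (n + k) \<le> real k * s n / (4752 * real M ^ 4)"
    and s_slow: "\<And>n m. N0 \<le> n \<Longrightarrow> n \<le> m \<Longrightarrow> real (m - n) * s n \<le> 9 * real M \<Longrightarrow> s n \<le> 2 * s m"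
    and M_large: "50 \<le> real M powr (\<delta> / 2)"
begin

lemma s_diff:
  assumes "N0 \<le> m" "m \<le> u" "u \<le> v" "v \<le> m + 9 * M\<^sup>2"
  shows "s u - s v \<le> real (v - u) * s m / (4752 * real M ^ 4)"
proof -
  have "s u - s (u + (v - u)) \<le> real (v - u) * s u / (4752 * real M ^ 4)"
    using assms by (intro s_close) auto
  also have "\<dots> \<le> real (v - u) * s m / (4752 * real M ^ 4)"
    using assms N0_pos s_antimono[of m u] by (intro divide_right_mono mult_left_mono) auto
  finally show ?thesis using assms by simp
qed

lemma M_ge1: "1 \<le> real M"
  using M_pos by simp

text \<open>At most 9 M^2 index steps, each losing a fraction 1 / (4752 M^4), lose 1 / (528 M^2) in
  total.\<close>

lemma s_half:
  assumes "N0 \<le> m" "k \<le> 9 * M\<^sup>2"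
  shows "s m / 2 \<le> s (m + k)" "s m - s m / (528 * (real M)\<^sup>2) \<le> s (m + k)"
proof -
  have sm: "0 < s m" using assms N0_pos by (intro s_pos) auto
  have "s m - s (m + k) \<le> real k * s m / (4752 * real M ^ 4)"
    using assms by (intro s_close) auto
  also have "\<dots> \<le> (9 * (real M)\<^sup>2) * s m / (4752 * real M ^ 4)"
  proof -
    have "real k \<le> 9 * (real M)\<^sup>2" using assms(2) by (metis of_nat_le_iff of_nat_mult of_nat_numeral of_nat_power)
    then show ?thesis using sm by (intro divide_right_mono mult_right_mono) auto
  qed
  also have "\<dots> = s m / (528 * (real M)\<^sup>2)"
    using M_pos by (simp add: field_simps power4_eq_xxxx power2_eq_square)
  finally have 1: "s m - s (m + k) \<le> s m / (528 * (real M)\<^sup>2)" .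
  then show "s m - s m / (528 * (real M)\<^sup>2) \<le> s (m + k)" by simp
  have "s m / (528 * (real M)\<^sup>2) \<le> s m / 2"
    using sm one_le_power[OF M_ge1, of 2] by (intro divide_left_mono) linarith+
  then show "s m / 2 \<le> s (m + k)" using 1 by linarith
qed

text \<open>The weight of a square of side \<open>s m\<close>: the unit in which the waste of a
  block starting at \<open>m\<close> is measured.\<close>

definition unit_weight :: "nat \<Rightarrow> real" where
  "unit_weight m = s m * s m powr \<delta>"

text \<open>A block of \<open>r\<close> rows of \<open>N\<close> squares, starting with square
  \<open>m\<close>, with lower left corner \<open>(a, p)\<close>. Its height exceeds
  \<open>r * s m\<close> by less than one square size, so little is left over on top.\<close>

context
  fixes m N r :: nat and a p h :: real
  assumes m: "N0 \<le> m" and N: "M \<le> N" "N \<le> 3 * M" and r: "M \<le> r" "r \<le> 3 * M"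
    and h: "real r * s m \<le> h" "h < (real r + 1) * s m"
begin

text \<open>Row \<open>j\<close> consists of the squares \<open>m + j * N + i\<close> for \<open>i < N\<close>, from left to right, and is
  aligned with the right edge of the block; \<open>stair_x j\<close> and \<open>stair_y j\<close> are the staircase on top
  of the first \<open>j\<close> rows.  As \<open>0 - 1 = 0\<close>, the staircase below row \<open>0\<close> uses the abscissae of row \<open>0\<close>
  itself.\<close>

definition "row_x j i = a + (\<Sum>k<N. s (m + k)) - (\<Sum>k\<in>{i..<N}. s (m + j * N + k))"
definition "stair_x j i = (if i = 0 then a else row_x (j - 1) i)"
definition "stair_y j i = p + (\<Sum>k<j. s (m + k * N + i))"

section \<open>Geometry of a block\<close>

lemma block_bounds: "0 < s m" "0 < N" "0 < r" "N * r \<le> 9 * M\<^sup>2" "real N \<le> 3 * real M" "real r \<le> 3 * real M"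
  using m N0_pos s_pos[of m] N r M_pos mult_mono[OF N(2) r(2)] by (auto simp: power2_eq_square)

lemma block_index: "j < r \<Longrightarrow> i < N \<Longrightarrow> j * N + i < N * r"
  using mult_le_mono1[of "Suc j" r N] by (simp add: mult.commute)

lemma s_block:
  assumes "j < r" "i < N"
  shows "s (m + j * N + i) \<le> s m" "s m / 2 \<le> s (m + j * N + i)"
    "s m - s m / (528 * (real M)\<^sup>2) \<le> s (m + j * N + i)" "0 < s (m + j * N + i)"
  using block_index[OF assms] block_bounds m N0_pos s_half[OF m, of "j * N + i"] s_antimono[of m "m + j * N + i"]
    s_pos[of "m + j * N + i"] by (auto simp: add.assoc)

lemma row_x_Suc: "i < N \<Longrightarrow> row_x j (Suc i) = row_x j i + s (m + j * N + i)"
  by (simp add: row_x_def sum.atLeast_Suc_lessThan)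

lemma row_x_N: "row_x j N = a + (\<Sum>k<N. s (m + k))"
  by (simp add: row_x_def)

lemma stair_x_N: "stair_x j N = row_x j N"
  using block_bounds by (simp add: stair_x_def row_x_N)

text \<open>The bound 27 M^3 comes from a row of at most 3 M squares, each compared with one at most
  9 M^2 indices away. It leaves ample room, since 27 / 4752 = 1 / 176.\<close>

lemma power_bound:
  assumes "0 \<le> b" "b \<le> 27 * real M ^ 3"
  shows "b * s m / (4752 * real M ^ 4) \<le> s m / (2 * real M)"
proof -
  have "b * s m / (4752 * real M ^ 4) \<le> (27 * real M ^ 3) * s m / (4752 * real M ^ 4)"
    using assms block_bounds by (intro divide_right_mono mult_right_mono) auto
  also have "\<dots> = s m / (176 * real M)" using M_pos by (simp add: field_simps power_numeral_reduce)
  also have "\<dots> \<le> s m / (2 * real M)" using block_bounds M_pos by (intro divide_left_mono) auto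
  finally show ?thesis .
qed

text \<open>All rows end at the same right edge, so the shift is the accumulated size difference of
  the squares from position \<open>l\<close> on; squares in equal positions of rows \<open>i\<close>
  and \<open>j\<close> are \<open>(j - i) * N\<close> indices apart.\<close>

lemma row_x_diff:
  assumes "i \<le> j" "j < r" "l \<le> N"
  shows "0 \<le> row_x j l - row_x i l" "row_x j l - row_x i l \<le> real N * (real ((j - i) * N) * s m / (4752 * real M ^ 4))"
proof -
  have eq: "row_x j l - row_x i l = (\<Sum>k\<in>{l..<N}. s (m + i * N + k) - s (m + j * N + k))"
    by (simp add: row_x_def sum_subtractf)
  have le: "i * N + k \<le> j * N + k" for k using assms by simp
  show "0 \<le> row_x j l - row_x i l"
    unfolding eq using m N0_pos le by (intro sum_nonneg) (auto intro!: s_antimono)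
  have "s (m + i * N + k) - s (m + j * N + k) \<le> real ((j - i) * N) * s m / (4752 * real M ^ 4)"
    if "k \<in> {l..<N}" for k
  proof -
    have "s (m + i * N + k) - s (m + j * N + k) \<le>
        real ((m + j * N + k) - (m + i * N + k)) * s m / (4752 * real M ^ 4)"
      using assms that block_index[of j k] block_bounds(4) m le by (intro s_diff) auto
    moreover have "(m + j * N + k) - (m + i * N + k) = (j - i) * N" by (simp add: diff_mult_distrib)
    ultimately show ?thesis by simp
  qed
  then have "row_x j l - row_x i l \<le> real (card {l..<N}) * (real ((j - i) * N) * s m / (4752 * real M ^ 4))"
    unfolding eq by (intro sum_bounded_above) auto
  also have "\<dots> \<le> real N * (real ((j - i) * N) * s m / (4752 * real M ^ 4))"
    using block_bounds by (intro mult_right_mono) auto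
  finally show "row_x j l - row_x i l \<le> real N * (real ((j - i) * N) * s m / (4752 * real M ^ 4))" .
qed

lemma row_x_close:
  assumes "i \<le> j" "j < r" "l \<le> N"
  shows "row_x j l - row_x i l \<le> s m / (2 * real M)"
proof -
  have "real N * real ((j - i) * N) \<le> (3 * real M) * ((3 * real M) * (3 * real M))"
    using block_bounds assms unfolding of_nat_mult by (intro mult_mono) auto
  also have "\<dots> = 27 * real M ^ 3" by (simp add: power3_eq_cube)
  finally have "(real N * real ((j - i) * N)) * s m / (4752 * real M ^ 4) \<le> s m / (2 * real M)"
    by (intro power_bound) auto
  then show ?thesis using row_x_diff(2)[OF assms] by simp
qed

lemma small_le_half: "s m / (2 * real M) \<le> s m / 2" "s m / (2 * real M) \<le> s m / real M"
  using block_bounds M_ge1 by (simp_all add: field_simps)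

lemma row_x_0: "row_x 0 0 = a"
  by (simp add: row_x_def lessThan_atLeast0)

text \<open>For \<open>i > 0\<close> this compares adjacent rows. For \<open>i = 0\<close> it
  compares row \<open>j\<close> with row \<open>0\<close>, whose left end is \<open>a\<close>, and
  so needs the bound for rows that are far apart.\<close>

lemma stair_x_le_row_x: "j < r \<Longrightarrow> i \<le> N \<Longrightarrow> stair_x j i \<le> row_x j i" "j < r \<Longrightarrow> i \<le> N \<Longrightarrow> row_x j i - stair_x j i \<le> s m / (2 * real M)"
  using row_x_diff(1)[of "j - 1" j i] row_x_diff(1)[of 0 j 0] row_x_close[of "j - 1" j i] row_x_close[of 0 j 0] row_x_0
  by (auto simp: stair_x_def)

text \<open>Shifts are at most \<open>s m / 2\<close>, and every square of the block is at least
  that wide.\<close>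

lemma row_x_le_stair_x: "j < r \<Longrightarrow> i < N \<Longrightarrow> row_x j i \<le> stair_x j (Suc i)"
  using stair_x_le_row_x(2)[of j "Suc i"] row_x_Suc[of i j] s_block(2)[of j i] small_le_half(1) by auto

lemma stair_y_Suc: "stair_y (Suc j) i = stair_y j i + s (m + j * N + i)"
  by (simp add: stair_y_def)

text \<open>Horizontal neighbours have consecutive indices, so each row below contributes the size
  difference of a single index step.\<close>

lemma stair_y_diff:
  assumes "j \<le> r" "Suc i < N"
  shows "stair_y j (Suc i) \<le> stair_y j i" "stair_y j i - stair_y j (Suc i) \<le> s m / (2 * real M)"
proof -
  have eq: "stair_y j i - stair_y j (Suc i) = (\<Sum>k<j. s (m + k * N + i) - s (m + k * N + Suc i))"
    by (simp add: stair_y_def sum_subtractf)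
  have "0 \<le> stair_y j i - stair_y j (Suc i)"
    unfolding eq using m N0_pos by (intro sum_nonneg) (auto intro!: s_antimono)
  then show "stair_y j (Suc i) \<le> stair_y j i" by simp
  have "s (m + k * N + i) - s (m + k * N + Suc i) \<le> 1 * s m / (4752 * real M ^ 4)" if "k < j" for k
    using s_diff[of m "m + k * N + i" "m + k * N + Suc i"] block_index[of k "Suc i"] assms that block_bounds(4) m by auto
  then have "stair_y j i - stair_y j (Suc i) \<le> real (card {..<j}) * (1 * s m / (4752 * real M ^ 4))"
    unfolding eq by (intro sum_bounded_above) auto
  also have "\<dots> = real j * s m / (4752 * real M ^ 4)" by simp
  also have "\<dots> \<le> s m / (2 * real M)"
  proof (intro power_bound)
    have "real j \<le> 3 * real M * 1" using assms block_bounds by auto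
    also have "\<dots> \<le> 3 * real M * (real M)\<^sup>2"
      using one_le_power[OF M_ge1, of 2] by (intro mult_left_mono) auto
    finally show "real j \<le> 27 * real M ^ 3" by (simp add: power3_eq_cube power2_eq_square)
  qed simp
  finally show "stair_y j i - stair_y j (Suc i) \<le> s m / (2 * real M)" .
qed

lemma stair_y_le: "j \<le> r \<Longrightarrow> i < N \<Longrightarrow> stair_y j i \<le> p + h"
proof -
  assume "j \<le> r" "i < N"
  then have "(\<Sum>k<j. s (m + k * N + i)) \<le> real (card {..<j}) * s m"
    by (intro sum_bounded_above) (auto intro!: s_block)
  also have "\<dots> \<le> real r * s m" using \<open>j \<le> r\<close> block_bounds by (intro mult_right_mono) auto
  finally show ?thesis using h by (simp add: stair_y_def)
qed

text \<open>One \<open>s m\<close> pays for the slack in \<open>h\<close>, the other for the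
  shrinking of the \<open>r\<close> squares of the column.\<close>

lemma stair_y_top: "i < N \<Longrightarrow> p + h - stair_y r i \<le> 2 * s m"
proof -
  assume i: "i < N"
  have "real (card {..<r}) * (s m - s m / (528 * (real M)\<^sup>2)) \<le> (\<Sum>k<r. s (m + k * N + i))"
    using i by (intro sum_bounded_below) (auto intro!: s_block)
  moreover have "real r * (s m / (528 * (real M)\<^sup>2)) \<le> s m"
  proof -
    have "real r \<le> 528 * (real M * real M)"
      using block_bounds(6) M_ge1 mult_right_mono[OF M_ge1, of "real M"] by linarith
    then have "real r * s m \<le> s m * (528 * (real M)\<^sup>2)" using block_bounds by (simp add: power2_eq_square)
    then show ?thesis using M_pos by (simp add: field_simps)
  qed
  ultimately show ?thesis using h by (simp add: stair_y_def algebra_simps)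
qed

section \<open>Weight of the waste in a block\<close>

lemma unit_weight_pos: "0 < unit_weight m"
  using block_bounds by (simp add: unit_weight_def)

lemma weight_le_unit:
  assumes "rvalid (u, v, w, z)" "v - u \<le> s m" "z - w \<le> s m"
  shows "weight \<delta> (u, v, w, z) \<le> unit_weight m"
  unfolding unit_weight_def using assms \<delta> by (intro weight_le) auto

lemma weight_le_4unit:
  assumes "rvalid (u, v, w, z)" "v - u \<le> 2 * s m" "z - w \<le> 2 * s m"
  shows "weight \<delta> (u, v, w, z) \<le> 4 * unit_weight m"
proof -
  have "weight \<delta> (u, v, w, z) \<le> (2 * s m) * (2 * s m) powr \<delta>"
    using assms \<delta> by (intro weight_le) auto
  also have "\<dots> \<le> (2 * s m) * (2 * s m powr \<delta>)"
    using \<delta> block_bounds powr_mono[of \<delta> 1 "2::real"] by (intro mult_left_mono) (auto simp: powr_mult)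
  finally show ?thesis by (simp add: unit_weight_def)
qed

text \<open>The gain 1 / M comes from the long side, which is why a hole must be small in both
  directions; for the short side the bound \<open>s m\<close> suffices.\<close>

lemma weight_hole:
  assumes "rvalid (u, v, w, z)" "v - u \<le> s m / real M" "z - w \<le> s m / real M"
  shows "weight \<delta> (u, v, w, z) \<le> unit_weight m / real M"
proof -
  have "weight \<delta> (u, v, w, z) \<le> (s m / real M) * (s m / real M) powr \<delta>"
    using assms \<delta> by (intro weight_le) auto
  also have "\<dots> \<le> (s m / real M) * s m powr \<delta>"
    using \<delta> block_bounds M_ge1 by (intro mult_left_mono powr_mono2) (auto simp: field_simps)
  finally show ?thesis by (simp add: unit_weight_def)
qed

lemma block_row:
  assumes "j < r"
  shows "\<exists>c. packs s c (m + j * N) (stair N (stair_x j) (stair_y j) (p + h)) (m + j * N + N)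
    (row_waste N (stair_x j) (row_x j) (stair_y j) (s (m + j * N)) @ stair N (stair_x (Suc j)) (stair_y (Suc j)) (p + h))"
proof (rule packs_row)
  show "0 < N" by (rule block_bounds)
  show "row_x j (Suc i) = row_x j i + s (m + j * N + i)" if "i < N" for i using that by (rule row_x_Suc)
  show "row_x j N = stair_x j N" by (simp add: stair_x_N)
  show "stair_x (Suc j) 0 = stair_x j 0" by (simp add: stair_x_def)
  show "stair_x (Suc j) i = row_x j i" if "0 < i" for i using that by (simp add: stair_x_def)
  show "stair_y (Suc j) i = stair_y j i + s (m + j * N + i)" for i by (rule stair_y_Suc)
  show "stair_x j i \<le> row_x j i" "row_x j i \<le> stair_x j (Suc i)" "0 \<le> s (m + j * N + i)" "stair_y (Suc j) i \<le> p + h"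
    if "i < N" for i
    using that assms stair_x_le_row_x(1) row_x_le_stair_x s_block(4) stair_y_le[of "Suc j" i] by (auto simp: less_imp_le)
  show "stair_y j (Suc i) \<le> stair_y j i" if "Suc i < N" for i using that assms by (intro stair_y_diff) auto
qed

text \<open>Fewer than \<open>N\<close> holes weigh at most 1 / M of a unit each. The left gap is as
  high as a square and is only bounded by a full unit.\<close>

lemma row_waste_weight:
  assumes "j < r"
  shows "total_weight \<delta> (row_waste N (stair_x j) (row_x j) (stair_y j) (s (m + j * N))) \<le> real N * (unit_weight m / real M) + unit_weight m"
proof -
  let ?L = "map (\<lambda>i. (stair_x j i, row_x j i, stair_y j i, stair_y j (i - 1))) [1..<N]"
  have "weight \<delta> (stair_x j i, row_x j i, stair_y j i, stair_y j (i - 1)) \<le> unit_weight m / real M" if "i \<in> {1..<N}" for i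
    using that assms stair_x_le_row_x[of j i] stair_y_diff[of j "i - 1"] small_le_half(2)
    by (intro weight_hole) auto
  then have "total_weight \<delta> ?L \<le> real (length ?L) * (unit_weight m / real M)"
    by (intro total_weight_le_length) auto
  also have "\<dots> \<le> real N * (unit_weight m / real M)"
    using unit_weight_pos by (intro mult_right_mono) auto
  finally have "total_weight \<delta> ?L \<le> real N * (unit_weight m / real M)" .
  moreover have "weight \<delta> (stair_x j 0, row_x j 0, stair_y j 0, stair_y j 0 + s (m + j * N)) \<le> unit_weight m"
    using assms stair_x_le_row_x[of j 0] small_le_half(1) s_block[of j 0] block_bounds by (intro weight_le_unit) auto
  ultimately show ?thesis by (simp add: row_waste_def)
qed

lemma top_weight: "total_weight \<delta> (stair N (stair_x r) (stair_y r) (p + h)) \<le> real N * (4 * unit_weight m)"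
proof -
  have r1: "r - 1 < r" using block_bounds by simp
  have "weight \<delta> (stair_x r i, stair_x r (Suc i), stair_y r i, p + h) \<le> 4 * unit_weight m" if i: "i < N" for i
  proof (intro weight_le_4unit)
    have "row_x (r - 1) i \<le> row_x (r - 1) (Suc i)" "row_x (r - 1) (Suc i) - row_x (r - 1) i \<le> s m"
      using row_x_Suc[OF i] s_block[OF r1 i] by auto
    \<comment> \<open>Column \<open>0\<close> starts at \<open>a\<close> and not at the left end of
      the last row, which accounts for the second \<open>s m\<close> of width.\<close>
    moreover have "stair_x r i \<le> row_x (r - 1) i" "row_x (r - 1) i - stair_x r i \<le> s m"
      using row_x_diff(1)[of 0 "r - 1" i] row_x_close[of 0 "r - 1" i] row_x_0 r1 i small_le_half(1) block_bounds
      by (auto simp: stair_x_def)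
    ultimately show "stair_x r (Suc i) - stair_x r i \<le> 2 * s m" "rvalid (stair_x r i, stair_x r (Suc i), stair_y r i, p + h)"
      using stair_y_le[of r i] i by (auto simp: stair_x_def)
    show "p + h - stair_y r i \<le> 2 * s m" by (rule stair_y_top[OF i])
  qed
  then have "total_weight \<delta> (stair N (stair_x r) (stair_y r) (p + h)) \<le>
      real (length (stair N (stair_x r) (stair_y r) (p + h))) * (4 * unit_weight m)"
    by (intro total_weight_le_length) (auto simp: stair_def)
  then show ?thesis by (simp add: stair_def)
qed

lemma block_rows:
  assumes "j \<le> r"
  shows "\<exists>c L. packs s c m [(a, a + (\<Sum>k<N. s (m + k)), p, p + h)] (m + j * N)
       (stair N (stair_x j) (stair_y j) (p + h) @ L) \<and>
     total_weight \<delta> L \<le> real j * (real N * (unit_weight m / real M) + unit_weight m)"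
  using assms
proof (induction j)
  case 0
  have "0 \<le> h" using h(1) block_bounds by (intro order_trans[OF mult_nonneg_nonneg h(1)]) auto
  then have "packs s c m [(stair_x 0 0, stair_x 0 N, p, p + h)] m (stair N (stair_x 0) (\<lambda>_. p) (p + h))" for c
    using block_bounds row_x_Suc[of _ 0] s_block(4)[of 0] row_x_0
    by (intro packs_columns) (auto simp: stair_x_def less_imp_le)
  moreover have "stair_x 0 0 = a" "stair_x 0 N = a + (\<Sum>k<N. s (m + k))" "stair_y 0 = (\<lambda>_. p)"
    using stair_x_N row_x_N by (auto simp: stair_x_def stair_y_def)
  ultimately show ?case by (intro exI[of _ undefined] exI[of _ "[]"]) simp
next
  case (Suc j)
  let ?T = "\<lambda>j. stair N (stair_x j) (stair_y j) (p + h)" and ?R = "[(a, a + (\<Sum>k<N. s (m + k)), p, p + h)]"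
  let ?w = "row_waste N (stair_x j) (row_x j) (stair_y j) (s (m + j * N))"
  obtain c L where L: "packs s c m ?R (m + j * N) (?T j @ L)"
    "total_weight \<delta> L \<le> real j * (real N * (unit_weight m / real M) + unit_weight m)"
    using Suc by auto
  obtain c' where "packs s c' (m + j * N) (?T j) (m + j * N + N) (?w @ ?T (Suc j))"
    using block_row[of j] Suc.prems by auto
  then have "packs s c' (m + j * N) (?T j @ L) (m + j * N + N) ((?w @ ?T (Suc j)) @ L)"
    using L(1) by (intro packs_frame) (auto simp: packs_def)
  then have "packs s c' (m + j * N) (?T j @ L) (m + j * N + N) (?T (Suc j) @ (?w @ L))"
    by (rule packs_perm) auto
  then have "packs s c' (m + j * N) (?T j @ L) (m + Suc j * N) (?T (Suc j) @ (?w @ L))"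
    by (simp add: algebra_simps)
  then obtain c'' where "packs s c'' m ?R (m + Suc j * N) (?T (Suc j) @ (?w @ L))"
    using L(1) packs_trans_ex by blast
  moreover have "total_weight \<delta> (?w @ L) \<le> real (Suc j) * (real N * (unit_weight m / real M) + unit_weight m)"
    using L(2) row_waste_weight[of j] Suc.prems by (simp add: distrib_right)
  ultimately show ?case by blast
qed

text \<open>The factor is 6 = 1 + 1 + 4, for the holes, the left gaps and the top; both
  \<open>N\<close> and \<open>r\<close> are at most \<open>N * r / M\<close>.\<close>

lemma block:
  "\<exists>c L. packs s c m [(a, a + (\<Sum>k<N. s (m + k)), p, p + h)] (m + N * r) L \<and>
     total_weight \<delta> L \<le> 6 * (real N * real r / real M) * unit_weight m"
proof -
  obtain c L where L: "packs s c m [(a, a + (\<Sum>k<N. s (m + k)), p, p + h)] (m + r * N)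
       (stair N (stair_x r) (stair_y r) (p + h) @ L)"
     "total_weight \<delta> L \<le> real r * (real N * (unit_weight m / real M) + unit_weight m)"
    using block_rows[of r] by auto
  have "real r \<le> real N * real r / real M" "real N \<le> real N * real r / real M"
    using N(1) r(1) M_pos by (auto simp: field_simps)
  then have "real r * unit_weight m \<le> (real N * real r / real M) * unit_weight m"
    "real N * unit_weight m \<le> (real N * real r / real M) * unit_weight m"
    using unit_weight_pos by (intro mult_right_mono; simp)+
  moreover have "real r * (real N * (unit_weight m / real M) + unit_weight m) =
      (real N * real r / real M) * unit_weight m + real r * unit_weight m"
    by (simp add: algebra_simps)
  ultimately have "total_weight \<delta> (stair N (stair_x r) (stair_y r) (p + h) @ L) \<le> 6 * ((real N * real r / real M) * unit_weight m)"
    using L(2) top_weight by simp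
  then have "total_weight \<delta> (stair N (stair_x r) (stair_y r) (p + h) @ L) \<le> 6 * (real N * real r / real M) * unit_weight m"
    by (simp only: mult.assoc)
  then show ?thesis using L(1) unfolding mult.commute[of r N] by blast
qed

end

end

section \<open>Cutting strips\<close>

context slowly_varying
begin

abbreviation "\<beta> \<equiv> real M powr (\<delta> / 2 - 1)"

text \<open>Sizes at most halve, so each term of the sum is at least a quarter of a unit; with
  \<beta> at least 50 / M the factor is 50 / 4, which exceeds 12. A block spends 6 of the 12, and
  the rest is kept for the end piece of a strip.\<close>

lemma unit_weight_le_sum:
  assumes "N0 \<le> m" "k \<le> 9 * M\<^sup>2"
  shows "12 * (real k / real M) * unit_weight m \<le> \<beta> * (\<Sum>i\<in>{m..<m + k}. s i powr (1 + \<delta>))"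
proof -
  have sm: "0 < s m" using assms N0_pos s_pos by auto
  have low: "unit_weight m / 4 \<le> s i powr (1 + \<delta>)" if "i \<in> {m..<m + k}" for i
  proof -
    have "s m / 2 \<le> s i" using s_half(1)[of m "i - m"] that assms by auto
    then have "(s m / 2) powr (1 + \<delta>) \<le> s i powr (1 + \<delta>)" using sm \<delta> by (intro powr_mono2) auto
    moreover have "(s m / 2) powr (1 + \<delta>) = s m powr (1 + \<delta>) / 2 powr (1 + \<delta>)"
      using sm by (simp add: powr_divide)
    moreover have "s m powr (1 + \<delta>) / 4 \<le> s m powr (1 + \<delta>) / 2 powr (1 + \<delta>)"
      using \<delta> powr_mono[of "1 + \<delta>" 2 "2::real"] by (intro divide_left_mono) auto
    moreover have "unit_weight m = s m powr (1 + \<delta>)"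
      using sm assms by (simp add: unit_weight_def powr_add)
    ultimately show ?thesis by linarith
  qed
  have U: "0 \<le> unit_weight m" using sm by (simp add: unit_weight_def)
  have \<beta>: "50 / real M \<le> \<beta>"
    using M_large M_pos by (simp add: powr_diff divide_right_mono)
  have "12 * (real k / real M) * unit_weight m \<le> (50 / real M) * (real (card {m..<m + k}) * (unit_weight m / 4))"
    using U M_pos by (simp add: field_simps)
  also have "\<dots> \<le> \<beta> * (\<Sum>i\<in>{m..<m + k}. s i powr (1 + \<delta>))"
    using \<beta> U by (intro mult_mono sum_bounded_below low) (auto intro!: sum_nonneg)
  finally show ?thesis .
qed

text \<open>Blocks are placed from left to right; \<open>n\<close> is the index fixing the height of
  the strip and \<open>m\<close> the current one. The last hypothesis bounds the number of squares
  already used in terms of the length already filled. It gives \<open>s n \<le> 2 * s m\<close> and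
  bounds \<open>m\<close>, so the induction terminates.\<close>

lemma strip:
  assumes n: "N0 \<le> n" and "n \<le> m" "b - a \<le> 1" "real M * s m \<le> b - a"
    and "real (m - n) * s n \<le> 9 * real M * (1 - (b - a))"
  shows "\<exists>c m' L. m < m' \<and> packs s c m [(a, b, p, p + real M * s n)] m' L \<and>
    total_weight \<delta> L \<le> \<beta> * (\<Sum>i\<in>{m..<m'}. s i powr (1 + \<delta>))"
  using assms(2-)
proof (induction "n + nat \<lfloor>9 * real M / s n\<rfloor> + 1 - m" arbitrary: m a rule: less_induct)
  case less
  define h where "h = real M * s n"
  note m = less.prems
  have sn: "0 < s n" using n N0_pos s_pos by auto
  have sm: "0 < s m" "s m \<le> s n" using n N0_pos m s_pos s_antimono[of n m] by auto
  have Mpos: "0 < real M" using M_pos by simp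
  have b_a: "0 \<le> b - a" using m(3) sm Mpos by (smt (verit) mult_pos_pos)
  have "9 * real M * (1 - (b - a)) \<le> 9 * real M * 1" using b_a by (intro mult_left_mono) auto
  then have count: "real (m - n) * s n \<le> 9 * real M" using m(4) by linarith
  then have snm: "s n \<le> 2 * s m" using n m by (intro s_slow) auto
  have m_bound: "m < n + nat \<lfloor>9 * real M / s n\<rfloor> + 1"
  proof -
    have "real (m - n) \<le> 9 * real M / s n" using count sn by (simp add: field_simps)
    then have "m - n \<le> nat \<lfloor>9 * real M / s n\<rfloor>" by (simp add: le_nat_floor)
    then show ?thesis by linarith
  qed
  define r where "r = nat \<lfloor>h / s m\<rfloor>"
  have h_pos: "0 < h" using sn Mpos by (simp add: h_def)
  have r_floor: "real r \<le> h / s m" "h / s m < real r + 1"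
    using h_pos sm by (auto simp: r_def)
  then have rh: "real r * s m \<le> h" "h < (real r + 1) * s m" using sm by (auto simp: field_simps)
  have r_bounds: "M \<le> r" "r \<le> 2 * M"
  proof -
    have "real M \<le> h / s m" using sm Mpos by (simp add: h_def field_simps mult_left_mono)
    then show "M \<le> r" unfolding r_def by (rule le_nat_floor)
    have "h / s m \<le> 2 * real M" using snm sm Mpos by (simp add: h_def field_simps)
    then have "real r \<le> real (2 * M)" using r_floor(1) by simp
    then show "r \<le> 2 * M" by (simp only: of_nat_le_iff)
  qed
  \<comment> \<open>While \<open>2 * M\<close> columns fit, a block takes only \<open>M\<close> of
    them, leaving at least \<open>M * s m\<close> for the next one; otherwise the last block takes
    all columns that fit.\<close>
  define wide where "wide \<longleftrightarrow> 2 * real M * s m \<le> b - a"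
  define N where "N = (if wide then M else nat \<lfloor>(b - a) / s m\<rfloor>)"
  have N_floor: "real N * s m \<le> b - a" "\<not> wide \<Longrightarrow> b - a < (real N + 1) * s m"
  proof -
    have "0 \<le> (b - a) / s m" using b_a sm by simp
    then have "real (nat \<lfloor>(b - a) / s m\<rfloor>) \<le> (b - a) / s m" "(b - a) / s m < real (nat \<lfloor>(b - a) / s m\<rfloor>) + 1"
      by auto
    then show "real N * s m \<le> b - a" "\<not> wide \<Longrightarrow> b - a < (real N + 1) * s m"
      using sm m(3) by (auto simp: N_def field_simps)
  qed
  have N_bounds: "M \<le> N" "N \<le> 2 * M"
  proof -
    have "real M \<le> (b - a) / s m" using m(3) sm by (simp add: field_simps)
    then show "M \<le> N" unfolding N_def by (auto intro: le_nat_floor)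
    show "N \<le> 2 * M"
    proof (cases wide)
      case False
      then have "real N * s m \<le> (2 * real M) * s m" using N_floor(1) by (simp add: wide_def)
      then have "real N \<le> real (2 * M)" using sm by simp
      then show ?thesis by (simp only: of_nat_le_iff)
    qed (simp add: N_def)
  qed
  have Nr: "N * r \<le> 9 * M\<^sup>2" using mult_mono[OF N_bounds(2) r_bounds(2)] by (simp add: power2_eq_square)
  have Nr_pos: "0 < N * r" using N_bounds r_bounds M_pos by auto
  define W where "W = (\<Sum>k<N. s (m + k))"
  have k_le: "k \<le> 9 * M\<^sup>2" if "k < N" for k
    using that Nr r_bounds(1) M_pos by (metis less_le_trans less_imp_le mult_le_mono2 nat_mult_1_right le_trans Suc_leI One_nat_def)
  have m_ge: "N0 \<le> m" using n m by simp
  have W_le: "W \<le> real N * s m"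
    unfolding W_def using sum_bounded_above[of "{..<N}" "\<lambda>k. s (m + k)" "s m"] s_antimono[of m] m_ge N0_pos by auto
  have W_ge: "real N * (s m / 2) \<le> W" "real N * (s m - s m / (528 * (real M)\<^sup>2)) \<le> W"
  proof -
    have "real (card {..<N}) * (s m / 2) \<le> W"
      unfolding W_def by (intro sum_bounded_below s_half(1)[OF m_ge k_le]) simp
    then show "real N * (s m / 2) \<le> W" by simp
    have "real (card {..<N}) * (s m - s m / (528 * (real M)\<^sup>2)) \<le> W"
      unfolding W_def by (intro sum_bounded_below s_half(2)[OF m_ge k_le]) simp
    then show "real N * (s m - s m / (528 * (real M)\<^sup>2)) \<le> W" by simp
  qed
  have "\<exists>c L. packs s c m [(a, a + W, p, p + h)] (m + N * r) L \<and>
     total_weight \<delta> L \<le> 6 * (real N * real r / real M) * unit_weight m"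
    unfolding W_def using m_ge N_bounds r_bounds rh by (intro block) auto
  then obtain c L where L: "packs s c m [(a, a + W, p, p + h)] (m + N * r) L"
     "total_weight \<delta> L \<le> 6 * (real N * real r / real M) * unit_weight m" by blast
  have W_pos: "0 \<le> W" using W_ge(1) sm by (smt (verit) mult_nonneg_nonneg divide_nonneg_nonneg of_nat_0_le_iff)
  have W_b: "a + W \<le> b" using W_le N_floor(1) by linarith
  have "packs s c m [(a, b, p, p + h)] m ([(a, a + W, p, p + h)] @ [(a + W, b, p, p + h)])"
    using packs_split_x[of a "a + W" b p "p + h" s c m] W_pos W_b h_pos by simp
  moreover have "packs s c m ([(a, a + W, p, p + h)] @ [(a + W, b, p, p + h)]) (m + N * r) (L @ [(a + W, b, p, p + h)])"
    using L(1) W_b h_pos by (intro packs_frame) auto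
  ultimately have split: "packs s c m [(a, b, p, p + h)] (m + N * r) (L @ [(a + W, b, p, p + h)])"
    by (rule packs_trans)
  define U where "U = (real N * real r / real M) * unit_weight m"
  let ?S = "\<lambda>u v. \<Sum>i\<in>{u..<v}. s i powr (1 + \<delta>)"
  have budget: "12 * U \<le> \<beta> * ?S m (m + N * r)"
    using unit_weight_le_sum[OF m_ge Nr] by (simp only: U_def of_nat_mult mult.assoc)
  have U: "0 \<le> U" using sm by (simp add: U_def unit_weight_def)
  have L_weight: "total_weight \<delta> L \<le> 6 * U" using L(2) by (simp only: U_def mult.assoc)
  show ?case
  proof (cases wide)
    case True
    have "\<exists>c m' L. m + N * r < m' \<and> packs s c (m + N * r) [(a + W, b, p, p + real M * s n)] m' L \<and>
      total_weight \<delta> L \<le> \<beta> * ?S (m + N * r) m'"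
    proof (rule less.hyps)
      show "n + nat \<lfloor>9 * real M / s n\<rfloor> + 1 - (m + N * r) < n + nat \<lfloor>9 * real M / s n\<rfloor> + 1 - m"
        using m_bound Nr_pos by linarith
      show "n \<le> m + N * r" "b - (a + W) \<le> 1" using m W_pos by auto
      have "real M * s (m + N * r) \<le> real M * s m"
        using s_antimono[of m "m + N * r"] m_ge N0_pos by (intro mult_left_mono) auto
      also have "\<dots> \<le> b - (a + W)" using True W_le by (simp add: wide_def N_def)
      finally show "real M * s (m + N * r) \<le> b - (a + W)" .
      \<comment> \<open>A block of width \<open>W\<close> holds at most
        \<open>8 * M * W / s n\<close> squares, so the constant 9 of the induction hypothesis is
        preserved.\<close>
      have "real (N * r) * s n \<le> (real N * (2 * real M)) * (2 * s m)"
        unfolding of_nat_mult using r_bounds snm sn by (intro mult_mono) auto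
      also have "\<dots> = 8 * real M * (real N * (s m / 2))" by simp
      also have "\<dots> \<le> 8 * real M * W" using W_ge(1) by (intro mult_left_mono) auto
      also have "\<dots> \<le> 9 * real M * W" using W_pos Mpos by simp
      finally have "real (N * r) * s n \<le> 9 * real M * W" .
      moreover have "real (m + N * r - n) * s n = real (m - n) * s n + real (N * r) * s n"
        using m(1) by (simp add: of_nat_diff algebra_simps)
      ultimately show "real (m + N * r - n) * s n \<le> 9 * real M * (1 - (b - (a + W)))"
        using m(4) by (simp add: algebra_simps)
    qed
    then obtain c' m' L' where L': "m + N * r < m'" "packs s c' (m + N * r) [(a + W, b, p, p + h)] m' L'"
      "total_weight \<delta> L' \<le> \<beta> * ?S (m + N * r) m'" unfolding h_def by blast
    have "packs s c' (m + N * r) ([(a + W, b, p, p + h)] @ L) m' (L' @ L)"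
      using L'(2) L(1) by (intro packs_frame) (auto simp: packs_def)
    then have "packs s c' (m + N * r) (L @ [(a + W, b, p, p + h)]) m' (L' @ L)"
      by (rule packs_perm) auto
    then have "\<exists>c. packs s c m [(a, b, p, p + h)] m' (L' @ L)"
      using split packs_trans_ex by blast
    moreover have "?S m m' = ?S m (m + N * r) + ?S (m + N * r) m'"
      using L'(1) by (simp add: sum.atLeastLessThan_concat)
    then have "\<beta> * ?S m m' = \<beta> * ?S m (m + N * r) + \<beta> * ?S (m + N * r) m'"
      by (simp add: distrib_left)
    then have "total_weight \<delta> (L' @ L) \<le> \<beta> * ?S m m'"
      unfolding total_weight_simps using L'(3) L_weight budget U by linarith
    moreover have "m < m'" using L'(1) by simp
    ultimately show ?thesis unfolding h_def by blast
  next
    case False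
    \<comment> \<open>One \<open>s m\<close> stems from rounding \<open>N\<close> down, the other
      from the shrinking of the squares. The end piece then weighs at most \<open>4 * U\<close>, and
      \<open>6 * U + 4 * U\<close> is within the budget \<open>12 * U\<close>.\<close>
    have "b - (a + W) \<le> 2 * s m"
    proof -
      have "real N \<le> 528 * (real M * real M)"
        using N_bounds(2) mult_right_mono[OF M_ge1, of "real M"] by linarith
      then have "real N * s m \<le> s m * (528 * (real M)\<^sup>2)" using sm by (simp add: power2_eq_square)
      then have "real N * (s m / (528 * (real M)\<^sup>2)) \<le> s m" using Mpos by (simp add: field_simps)
      then show ?thesis using W_ge(2) N_floor(2)[OF False] by (simp add: algebra_simps)
    qed
    moreover have "h \<le> 2 * real r * s m"
    proof -
      have "1 * s m \<le> real r * s m" using r_bounds M_pos sm by (intro mult_right_mono) auto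
      then show ?thesis using rh(2) by (simp add: algebra_simps)
    qed
    moreover have "2 * s m \<le> 2 * real r * s m" using r_bounds M_pos sm by auto
    ultimately have "weight \<delta> (a + W, b, p, p + h) \<le> (2 * real r * s m) * (2 * s m) powr \<delta>"
      using W_b h_pos \<delta> by (intro weight_le) auto
    also have "\<dots> \<le> (2 * real r * s m) * (2 * s m powr \<delta>)"
      using \<delta> sm powr_mono[of \<delta> 1 "2::real"] by (intro mult_left_mono) (auto simp: powr_mult)
    also have "\<dots> = 4 * (real r * unit_weight m)" by (simp add: unit_weight_def)
    also have "real r * unit_weight m \<le> U" unfolding U_def
    proof (intro mult_right_mono)
      show "real r \<le> real N * real r / real M" using N_bounds Mpos by (simp add: field_simps mult_right_mono)
    qed (use sm in \<open>simp add: unit_weight_def\<close>)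
    finally have "total_weight \<delta> (L @ [(a + W, b, p, p + h)]) \<le> \<beta> * ?S m (m + N * r)"
      unfolding total_weight_simps using L_weight budget U by linarith
    moreover have "m < m + N * r" using Nr_pos by simp
    ultimately show ?thesis using split unfolding h_def by blast
  qed
qed

text \<open>What remains above the strip keeps the long side and has a smaller short side, so it
  weighs no more than the whole rectangle; only the waste inside the strip is new.\<close>

lemma cut_strip_horizontal:
  assumes "N0 \<le> n" "real M * s n \<le> q - p" "q - p \<le> b - a" "b - a \<le> 1"
  shows "\<exists>c n' L. n < n' \<and> packs s c n [(a, b, p, q)] n' L \<and>
    total_weight \<delta> L \<le> weight \<delta> (a, b, p, q) + \<beta> * (\<Sum>i\<in>{n..<n'}. s i powr (1 + \<delta>))"
proof -
  let ?y = "p + real M * s n"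
  have "0 < s n" using assms N0_pos s_pos by auto
  then have Ms: "0 \<le> real M * s n" by simp
  have "\<exists>c n' L. n < n' \<and> packs s c n [(a, b, p, ?y)] n' L \<and>
    total_weight \<delta> L \<le> \<beta> * (\<Sum>i\<in>{n..<n'}. s i powr (1 + \<delta>))"
    using assms by (intro strip) auto
  then obtain c n' L where L: "n < n'" "packs s c n [(a, b, p, ?y)] n' L"
    "total_weight \<delta> L \<le> \<beta> * (\<Sum>i\<in>{n..<n'}. s i powr (1 + \<delta>))" by blast
  have "packs s c n [(a, b, p, q)] n ([(a, b, p, ?y)] @ [(a, b, ?y, q)])"
    using assms Ms packs_split_y[of a b p ?y q s c n] by simp
  moreover have "packs s c n ([(a, b, p, ?y)] @ [(a, b, ?y, q)]) n' (L @ [(a, b, ?y, q)])"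
    using L assms Ms by (intro packs_frame) auto
  ultimately have "packs s c n [(a, b, p, q)] n' (L @ [(a, b, ?y, q)])" by (rule packs_trans)
  moreover have "weight \<delta> (a, b, ?y, q) \<le> (b - a) * (q - p) powr \<delta>"
    using assms Ms \<delta> by (intro weight_le) auto
  moreover have "weight \<delta> (a, b, p, q) = (b - a) * (q - p) powr \<delta>" using assms by (simp add: max_def min_def)
  ultimately show ?thesis using L by (intro exI[of _ c] exI[of _ n'] exI[of _ "L @ [(a, b, ?y, q)]"]) auto
qed

lemma cut_strip:
  assumes "N0 \<le> n" "real M * s n \<le> b - a" "real M * s n \<le> q - p" "b - a \<le> 1" "q - p \<le> 1"
  shows "\<exists>c n' L. n < n' \<and> packs s c n [(a, b, p, q)] n' L \<and>
    total_weight \<delta> L \<le> weight \<delta> (a, b, p, q) + \<beta> * (\<Sum>i\<in>{n..<n'}. s i powr (1 + \<delta>))"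
proof (cases "q - p \<le> b - a")
  case True
  then show ?thesis using assms by (intro cut_strip_horizontal)
next
  case False
  then obtain c n' L where L: "n < n'" "packs s c n [(p, q, a, b)] n' L"
    "total_weight \<delta> L \<le> weight \<delta> (p, q, a, b) + \<beta> * (\<Sum>i\<in>{n..<n'}. s i powr (1 + \<delta>))"
    using cut_strip_horizontal[of n b a q p] assms by auto
  have "packs s (prod.swap \<circ> c) n [(a, b, p, q)] n' (map rswap L)"
    using packs_rswap[OF L(2)] by simp
  moreover have "weight \<delta> (p, q, a, b) = weight \<delta> (a, b, p, q)"
    using weight_rswap[of \<delta> "(p, q, a, b)"] by simp
  ultimately show ?thesis using L(1,3) total_weight_rswap[of \<delta> L] by metis
qed

text \<open>If every short side were below \<open>M * s n\<close>, then area = weight times short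
  side to the power 1 - \<delta> would contradict \<open>large\<close>. So a strip can be cut from
  some rectangle of the list.\<close>

lemma cut_strip_list:
  assumes n: "N0 \<le> n" and valid: "\<And>R. R \<in> set L \<Longrightarrow> rvalid R"
    and sides: "\<And>a b p q. (a, b, p, q) \<in> set L \<Longrightarrow> b - a \<le> 1 \<and> q - p \<le> 1"
    and large: "(real M * s n) powr (1 - \<delta>) * total_weight \<delta> L < total_area L"
  shows "\<exists>c n' L'. n < n' \<and> packs s c n L n' L' \<and>
    total_weight \<delta> L' \<le> total_weight \<delta> L + \<beta> * (\<Sum>i\<in>{n..<n'}. s i powr (1 + \<delta>))"
proof -
  let ?h = "real M * s n"
  have "\<exists>a b p q. (a, b, p, q) \<in> set L \<and> ?h \<le> b - a \<and> ?h \<le> q - p"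
  proof (rule ccontr)
    assume no: "\<not> ?thesis"
    have "rarea R \<le> ?h powr (1 - \<delta>) * weight \<delta> R" if "R \<in> set L" for R
    proof -
      obtain a b p q where R: "R = (a, b, p, q)" by (cases R) auto
      let ?u = "max (b - a) (q - p)" and ?v = "min (b - a) (q - p)"
      have v: "0 \<le> ?v" "?v \<le> ?h" "0 \<le> ?u" using no valid[OF that] that R by (force simp: min_def max_def)+
      have "rarea R = ?u * ?v" by (simp add: R max_def min_def)
      also have "\<dots> = ?u * (?v powr \<delta> * ?v powr (1 - \<delta>))"
        using v \<delta> by (cases "?v = 0") (simp_all add: powr_add[symmetric])
      also have "\<dots> = ?v powr (1 - \<delta>) * weight \<delta> R" by (simp add: R)
      also have "\<dots> \<le> ?h powr (1 - \<delta>) * weight \<delta> R"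
        using v \<delta> weight_nonneg[OF valid[OF that]] by (intro mult_right_mono powr_mono2) auto
      finally show ?thesis .
    qed
    then have "total_area L \<le> (\<Sum>R\<leftarrow>L. ?h powr (1 - \<delta>) * weight \<delta> R)"
      unfolding total_area_def by (intro sum_list_mono) auto
    then show False using large by (simp add: total_weight_def sum_list_const_mult)
  qed
  then obtain a b p q where R: "(a, b, p, q) \<in> set L" "?h \<le> b - a" "?h \<le> q - p" by blast
  let ?R = "(a, b, p, q)" and ?L = "remove1 (a, b, p, q) L"
  have perm: "mset L = mset ([?R] @ ?L)" using R(1) by simp
  obtain c n' L' where L': "n < n'" "packs s c n [?R] n' L'"
    "total_weight \<delta> L' \<le> weight \<delta> ?R + \<beta> * (\<Sum>i\<in>{n..<n'}. s i powr (1 + \<delta>))"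
    using cut_strip[OF n R(2,3)] sides[OF R(1)] by auto
  have "packs s c n ([?R] @ ?L) n' (L' @ ?L)"
    using L'(2) valid by (intro packs_frame) (auto dest: set_remove1_subset[THEN subsetD])
  then have "packs s c n L n' (L' @ ?L)" by (rule packs_perm) (use perm in auto)
  moreover have "total_weight \<delta> L = total_weight \<delta> ([?R] @ ?L)"
    unfolding total_weight_def using perm by (metis mset_map sum_mset_sum_list)
  then have "total_weight \<delta> (L' @ ?L) \<le> total_weight \<delta> L + \<beta> * (\<Sum>i\<in>{n..<n'}. s i powr (1 + \<delta>))"
    using L'(3) by simp
  ultimately show ?thesis using L'(1) by blast
qed

end

section \<open>The infinite packing\<close>

lemma planar_square_sq:
  assumes "0 < a"
  shows "planar_square a (rset (sq p a))"
proof -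
  have "rset (sq p a) = {p + x *\<^sub>R (1, 0) + y *\<^sub>R (0, 1) | x y. 0 \<le> x \<and> x \<le> a \<and> 0 \<le> y \<and> y \<le> a}"
  proof (intro set_eqI iffI)
    fix z assume "z \<in> rset (sq p a)"
    then show "z \<in> {p + x *\<^sub>R (1, 0) + y *\<^sub>R (0, 1) | x y. 0 \<le> x \<and> x \<le> a \<and> 0 \<le> y \<and> y \<le> a}"
      by (intro CollectI exI[of _ "fst z - fst p"] exI[of _ "snd z - snd p"])
        (auto simp: sq_def prod_eq_iff)
  qed (cases p, auto simp: sq_def)
  then show ?thesis using assms unfolding planar_square_def
    by (intro conjI exI[of _ p] exI[of _ "(1, 0)"] exI[of _ "(0, 1)"]) (auto simp: norm_Pair)
qed

text \<open>\<open>start\<close> is the weight bound for the big square before anything is placed;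
  \<open>large_rectangle\<close> says that this bound always leaves a rectangle to cut from;
  \<open>tail_le_1\<close> keeps the sides at most 1, as strips require.\<close>

locale packable = slowly_varying +
  assumes s_summable: "summable (\<lambda>n. (s n)\<^sup>2)"
    and tail_le_1: "\<And>n. N0 \<le> n \<Longrightarrow> (\<Sum>k. (s (n + k))\<^sup>2) \<le> 1"
    and start: "\<And>n. N0 \<le> n \<Longrightarrow>
      (\<Sum>k. (s (n + k))\<^sup>2) powr ((1 + \<delta>) / 2) \<le> \<beta> * (\<Sum>i\<in>{1..<n}. s i powr (1 + \<delta>))"
    and large_rectangle: "\<And>n. N0 \<le> n \<Longrightarrow>
      (real M * s n) powr (1 - \<delta>) * (\<beta> * (\<Sum>i\<in>{1..<n}. s i powr (1 + \<delta>))) < (\<Sum>k. (s (n + k))\<^sup>2)"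
begin

definition "tail n = (\<Sum>k. (s (n + k))\<^sup>2)"

lemma tail_split: "n \<le> n' \<Longrightarrow> tail n = (\<Sum>i\<in>{n..<n'}. (s i)\<^sup>2) + tail n'"
proof -
  assume le: "n \<le> n'"
  have summ: "summable (\<lambda>k. (s (n + k))\<^sup>2)"
    using s_summable by (subst add.commute, subst summable_iff_shift)
  have "tail n = (\<Sum>k. (s (n + (k + (n' - n))))\<^sup>2) + (\<Sum>k<n' - n. (s (n + k))\<^sup>2)"
    unfolding tail_def by (rule suminf_split_initial_segment[OF summ])
  moreover have "n + (k + (n' - n)) = n' + k" for k using le by simp
  moreover have "(\<Sum>k<n' - n. (s (n + k))\<^sup>2) = (\<Sum>i\<in>{n..<n'}. (s i)\<^sup>2)"
    using le sum.shift_bounds_nat_ivl[of "\<lambda>i. (s i)\<^sup>2" 0 n "n' - n"] by (simp add: lessThan_atLeast0 add.commute)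
  ultimately show ?thesis by (simp add: tail_def)
qed

lemma tail_tendsto_0: "tail \<longlonglongrightarrow> 0"
proof -
  have eq: "tail n = tail 0 - (\<Sum>i<n. (s i)\<^sup>2)" for n
    using tail_split[of 0 n] by (simp add: lessThan_atLeast0)
  have "(\<lambda>n. \<Sum>i<n. (s i)\<^sup>2) \<longlonglongrightarrow> tail 0"
    using summable_LIMSEQ[OF s_summable] by (simp add: tail_def)
  then have "(\<lambda>n. tail 0 - (\<Sum>i<n. (s i)\<^sup>2)) \<longlonglongrightarrow> tail 0 - tail 0" by (intro tendsto_intros)
  then show ?thesis unfolding eq[symmetric] by simp
qed

lemma tail_pos:
  assumes "1 \<le> n"
  shows "0 < tail n"
proof -
  have summ: "summable (\<lambda>k. (s (Suc n + k))\<^sup>2)"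
    using s_summable by (subst add.commute, subst summable_iff_shift)
  have "0 \<le> tail (Suc n)" unfolding tail_def using summ by (intro suminf_nonneg) auto
  then show ?thesis using tail_split[of n "Suc n"] s_pos[OF assms] by (simp add: add_pos_nonneg)
qed

text \<open>The sum starts at 1 and not at the first index packed: the share of the earlier indices,
  whose squares are never placed, is the credit that pays for the weight of the initial big
  square.\<close>

definition invariant :: "rect \<Rightarrow> nat \<Rightarrow> rect list \<Rightarrow> bool" where
  "invariant \<Omega> n L \<longleftrightarrow> N0 \<le> n \<and> (\<forall>R\<in>set L. rvalid R) \<and> cover L \<subseteq> rset \<Omega> \<and>
     total_area L = tail n \<and> total_weight \<delta> L \<le> \<beta> * (\<Sum>i\<in>{1..<n}. s i powr (1 + \<delta>))"

lemma invariant_step: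
  assumes inv: "invariant (u, v, w, z) n L" and small: "v - u \<le> 1" "z - w \<le> 1"
  shows "\<exists>c n' L'. n < n' \<and> packs s c n L n' L' \<and> invariant (u, v, w, z) n' L'"
proof -
  let ?S = "\<lambda>n. \<Sum>i\<in>{1..<n}. s i powr (1 + \<delta>)"
  have n: "N0 \<le> n" and valid: "\<And>R. R \<in> set L \<Longrightarrow> rvalid R" using inv by (auto simp: invariant_def)
  have "(real M * s n) powr (1 - \<delta>) * total_weight \<delta> L \<le> (real M * s n) powr (1 - \<delta>) * (\<beta> * ?S n)"
    using inv by (intro mult_left_mono) (auto simp: invariant_def)
  also have "\<dots> < total_area L" using large_rectangle[OF n] inv by (simp add: invariant_def tail_def)
  finally have large: "(real M * s n) powr (1 - \<delta>) * total_weight \<delta> L < total_area L" .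
  have "b - a \<le> 1 \<and> q - p \<le> 1" if "(a, b, p, q) \<in> set L" for a b p q
  proof -
    have "rset (a, b, p, q) \<subseteq> rset (u, v, w, z)" using that inv unfolding invariant_def cover_def by blast
    moreover have "(a, p) \<in> rset (a, b, p, q)" "(b, q) \<in> rset (a, b, p, q)" using valid[OF that] by auto
    ultimately have "(a, p) \<in> rset (u, v, w, z)" "(b, q) \<in> rset (u, v, w, z)" by blast+
    then show ?thesis using small by auto
  qed
  then obtain c n' L' where L': "n < n'" "packs s c n L n' L'"
    "total_weight \<delta> L' \<le> total_weight \<delta> L + \<beta> * (\<Sum>i\<in>{n..<n'}. s i powr (1 + \<delta>))"
    using cut_strip_list[OF n valid _ large] by blast
  have "?S n' = ?S n + (\<Sum>i\<in>{n..<n'}. s i powr (1 + \<delta>))"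
    using L'(1) n N0_pos by (simp add: sum.atLeastLessThan_concat)
  then have "\<beta> * ?S n' = \<beta> * ?S n + \<beta> * (\<Sum>i\<in>{n..<n'}. s i powr (1 + \<delta>))" by (simp add: distrib_left)
  then have "total_weight \<delta> L' \<le> \<beta> * ?S n'" using L'(3) inv unfolding invariant_def by linarith
  moreover have "total_area L' = tail n'"
    using L'(1,2) inv tail_split[of n n'] by (simp add: invariant_def packs_def)
  ultimately have "invariant (u, v, w, z) n' L'"
    using L'(1,2) inv unfolding invariant_def packs_def by auto
  then show ?thesis using L' by blast
qed

theorem squares_pack_perfectly_into_square:
  assumes n0: "N0 \<le> n0"
  defines "a \<equiv> sqrt (tail n0)"
  shows "squares_pack_perfectly s n0 (rset (sq (0, 0) a))"
proof -
  let ?\<Omega> = "(0, a, 0, a)"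
  have Omega: "rset (sq (0, 0) a) = rset ?\<Omega>" by (simp add: sq_def)
  have tail0: "0 < tail n0" "tail n0 \<le> 1"
    using n0 N0_pos tail_pos[of n0] tail_le_1[OF n0] by (auto simp: tail_def)
  have a: "0 < a" "a \<le> 1" "a * a = tail n0" using tail0 by (auto simp: a_def)
  have init_inv: "invariant ?\<Omega> n0 [?\<Omega>]"
  proof -
    have "a * a powr \<delta> = tail n0 powr ((1 + \<delta>) / 2)"
      using tail0 by (simp add: a_def powr_half_sqrt[symmetric] powr_powr powr_add[symmetric] add_divide_distrib)
    then show ?thesis using n0 a start[OF n0] by (simp add: invariant_def tail_def)
  qed
  \<comment> \<open>A state consists of the next index, the current rectangles and the positions
    chosen in the step leading to it. The clause for \<open>k = 0\<close> pins down the initial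
    state, since dependent choice only yields some state satisfying \<open>P 0\<close>.\<close>
  define P :: "nat \<Rightarrow> nat \<times> rect list \<times> (nat \<Rightarrow> real \<times> real) \<Rightarrow> bool" where
    "P k x \<longleftrightarrow> invariant ?\<Omega> (fst x) (fst (snd x)) \<and> (k = 0 \<longrightarrow> fst x = n0 \<and> fst (snd x) = [?\<Omega>])" for k x
  define T :: "nat \<times> rect list \<times> (nat \<Rightarrow> real \<times> real) \<Rightarrow> nat \<times> rect list \<times> (nat \<Rightarrow> real \<times> real) \<Rightarrow> bool" where
    "T x y \<longleftrightarrow> fst x < fst y \<and> packs s (snd (snd y)) (fst x) (fst (snd x)) (fst y) (fst (snd y))" for x y
  have "P 0 (n0, [?\<Omega>], undefined)" using init_inv by (simp add: P_def)
  then have "\<exists>x. P 0 x" by blast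
  moreover have "\<exists>y. P (Suc k) y \<and> T x y" if "P k x" for k x
  proof -
    have "\<exists>c n' L'. fst x < n' \<and> packs s c (fst x) (fst (snd x)) n' L' \<and> invariant ?\<Omega> n' L'"
      using that a by (intro invariant_step) (auto simp: P_def)
    then obtain c n' L' where "fst x < n'" "packs s c (fst x) (fst (snd x)) n' L'" "invariant ?\<Omega> n' L'" by blast
    then have "P (Suc k) (n', L', c) \<and> T x (n', L', c)" by (simp add: P_def T_def)
    then show ?thesis by blast
  qed
  ultimately obtain F where F: "\<And>k. P k (F k)" "\<And>k. T (F k) (F (Suc k))"
    using dependent_nat_choice[of P "\<lambda>_. T"] by metis
  define n where "n k = fst (F k)" for k
  define L where "L k = fst (snd (F k))" for k
  define C where "C k = snd (snd (F k))" for k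
  have inv: "invariant ?\<Omega> (n k) (L k)" and init: "n 0 = n0" "L 0 = [?\<Omega>]"
    and step: "n k < n (Suc k)" "packs s (C (Suc k)) (n k) (L k) (n (Suc k)) (L (Suc k))" for k
    using F(1)[of k] F(1)[of 0] F(2)[of k] by (auto simp: P_def T_def n_def L_def C_def)
  have mono: "strict_mono n" using step(1) by (simp add: strict_mono_Suc_iff)
  \<comment> \<open>Square \<open>m\<close> takes its position from the unique step that places
    it.\<close>
  define c where "c m = C (Suc (LEAST k. m < n (Suc k))) m" for m
  have c: "c m = C (Suc k) m" if "n k \<le> m" "m < n (Suc k)" for m k
  proof -
    have "(LEAST k. m < n (Suc k)) = k"
    proof (rule Least_equality)
      show "m < n (Suc k)" by (rule that)
      fix j assume "m < n (Suc j)"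
      then have "n k < n (Suc j)" using that(1) by simp
      then show "k \<le> j" using mono by (simp add: strict_mono_less)
    qed
    then show ?thesis by (simp add: c_def)
  qed
  have packs: "packs s c n0 [?\<Omega>] (n k) (L k)" for k
  proof (induction k)
    case 0
    show ?case using a by (simp add: init packs_def)
  next
    case (Suc k)
    have "packs s c (n k) (L k) (n (Suc k)) (L (Suc k))"
      using packs_cong[OF step(2), of k c] c[of k] by simp
    with Suc show ?case by (rule packs_trans)
  qed
  have n_ge: "k \<le> n k" for k using mono by (rule strict_mono_imp_increasing)
  define Q where "Q m = rset (sq (c m) (s m))" for m
  have in_Omega: "Q m \<subseteq> rset ?\<Omega>" if "n0 \<le> m" for m
  proof -
    have "m \<in> {n0..<n (Suc m)}" using n_ge[of "Suc m"] that by auto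
    then have "rset (sq (c m) (s m)) \<subseteq> cover [?\<Omega>]" using packs[of "Suc m"] unfolding packs_def by blast
    then show ?thesis by (simp add: Q_def)
  qed
  have disjoint: "interior (Q i) \<inter> interior (Q j) = {}" if "n0 \<le> i" "n0 \<le> j" "i \<noteq> j" for i j
  proof -
    define k where "k = Suc (max i j)"
    have "i \<in> {n0..<n k}" "j \<in> {n0..<n k}" using n_ge[of k] that by (auto simp: k_def)
    then have "negligible (Q i \<inter> Q j)"
      unfolding Q_def
      by (rule packs_negligible_Int[OF packs, rotated 2])
        (use a that n0 N0_pos s_pos in \<open>auto intro: less_imp_le\<close>)
    moreover have "interior (Q i) \<inter> interior (Q j) \<subseteq> Q i \<inter> Q j" by (intro Int_mono interior_subset)
    ultimately have "negligible (interior (Q i) \<inter> interior (Q j))" by (rule negligible_subset)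
    then show ?thesis using open_not_negligible[OF open_Int[OF open_interior open_interior]] by metis
  qed
  \<comment> \<open>At every stage the uncovered part lies in \<open>cover (L k)\<close>, whose
    measure is at most \<open>tail (n k)\<close>, and this tends to 0.\<close>
  have "negligible (rset ?\<Omega> - (\<Union>m\<in>{n0..}. Q m))"
    unfolding negligible_outer
  proof (intro allI impI)
    fix e :: real assume "0 < e"
    have "(\<lambda>k. tail (n k)) \<longlonglongrightarrow> 0"
      using LIMSEQ_subseq_LIMSEQ[OF tail_tendsto_0 mono] by (simp add: comp_def)
    then obtain k where k: "tail (n k) < e"
      using \<open>0 < e\<close> order_tendstoD(2)[of _ 0 sequentially e] eventually_sequentially by (metis order_refl)
    have "rset ?\<Omega> - (\<Union>m\<in>{n0..}. Q m) \<subseteq> cover (L k)"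
      using packs[of k] unfolding packs_def Q_def by auto
    moreover have "measure lebesgue (cover (L k)) \<le> tail (n k)"
      using measure_cover_le[of "L k"] inv[of k] by (simp add: invariant_def)
    ultimately show "\<exists>T. rset ?\<Omega> - (\<Union>m\<in>{n0..}. Q m) \<subseteq> T \<and> T \<in> lmeasurable \<and> measure lebesgue T < e"
      using measurable_cover k by (intro exI[of _ "cover (L k)"]) auto
  qed
  moreover have "planar_square (s m) (Q m)" if "n0 \<le> m" for m
    unfolding Q_def using that n0 N0_pos by (intro planar_square_sq s_pos) auto
  moreover have "packed_into {n0..} Q (rset ?\<Omega>)"
    unfolding packed_into_def disjoint_family_on_def using in_Omega disjoint by simp
  ultimately show ?thesis
    unfolding squares_pack_perfectly_def perfectly_packed_into_def Omega by blast
qed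

end

section \<open>The theorem\<close>

lemma smooth_on_DERIV:
  assumes "smooth_on {a..} f" "a < x"
  shows "(f has_real_derivative deriv f x) (at x)"
proof -
  obtain F where F: "\<And>x. a \<le> x \<Longrightarrow> F 0 x = f x"
    "\<And>k x. a \<le> x \<Longrightarrow> (F k has_real_derivative F (Suc k) x) (at x within {a..})"
    using assms(1) unfolding smooth_on_def by auto
  have "(F 0 has_real_derivative F 1 x) (at x within {a..})" using F(2)[of x 0] assms(2) by simp
  moreover have "at x within {a..} = at x" using assms(2) by (intro at_within_interior) simp
  ultimately have "(F 0 has_real_derivative F 1 x) (at x)" by simp
  then have "(f has_real_derivative F 1 x) (at x)"
    by (rule has_field_derivative_transform_within_open[of _ _ _ "{a<..}"]) (use assms(2) F(1) in auto)
  then show ?thesis using DERIV_imp_deriv by metis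
qed

text \<open>Since (1 + u)^(-t) \<ge> (1 + u)^(-1) \<ge> 1 - u, a relative growth \<open>u\<close> of
  the base costs at most a relative loss \<open>u\<close>.\<close>

lemma powr_minus_close:
  fixes t x y u :: real
  assumes "0 < t" "t < 1" "0 < x" "0 < y" "0 \<le> u" "y \<le> x * (1 + u)"
  shows "x powr (- t) - y powr (- t) \<le> u * x powr (- t)"
proof -
  have "(x * (1 + u)) powr (- t) \<le> y powr (- t)" using assms by (intro powr_mono2') auto
  moreover have "(x * (1 + u)) powr (- t) = x powr (- t) * (1 + u) powr (- t)" using assms by (simp add: powr_mult)
  moreover have "1 - u \<le> (1 + u) powr (- t)"
  proof -
    have "(1 - u) * (1 + u) \<le> 1" by (simp add: algebra_simps)
    then have "1 - u \<le> 1 / (1 + u)" using assms by (simp add: field_simps)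
    also have "\<dots> = (1 + u) powr (- 1)" using assms by (simp add: powr_minus field_simps)
    also have "\<dots> \<le> (1 + u) powr (- t)" using assms by (intro powr_mono) auto
    finally show ?thesis .
  qed
  then have "x powr (- t) * (1 - u) \<le> x powr (- t) * (1 + u) powr (- t)" by (intro mult_left_mono) auto
  ultimately show ?thesis by (simp add: algebra_simps)
qed

theorem theorem1p1:
  fixes t \<delta> c1 c2 d1 d2 c_lam_nu l K :: real
    and \<nu>1 \<nu>2 lam1 lam2 :: "nat \<Rightarrow> real"
    and \<xi>1 \<xi>2 \<eta>1 \<eta>2 :: "real \<Rightarrow> real"
    and M N0 N1 :: nat
    and f :: "real \<Rightarrow> real"
  assumes t: "1/2 < t" "t < 1"
    and \<delta>: "\<delta> = 1 - t"
    and const_pos: "0 < c1" "0 < c2" "0 < d1" "0 < d2" "0 < c_lam_nu" "0 < l" "0 < K"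
    and seq_pos: "\<And>n. 1 \<le> n \<Longrightarrow> 0 < \<nu>1 n \<and> 0 < \<nu>2 n \<and> 0 < lam1 n \<and> 0 < lam2 n"
    and \<xi>\<eta>_pos: "\<And>s. s \<in> {1/2<..<1} \<Longrightarrow> 0 < \<xi>1 s \<and> 0 < \<xi>2 s \<and> 0 < \<eta>1 s \<and> 0 < \<eta>2 s"
    and nat_pos: "0 < M" "0 < N0" "0 < N1" "N1 < N0"
    and f_pos: "\<And>x. 1 \<le> x \<Longrightarrow> 0 < f x"
    and f_smooth: "smooth_on {1..} f"
    and f_mono: "mono_on {1..} f"
    and cond1: "\<And>n0. N0 \<le> n0 \<Longrightarrow> f (real n0) \<ge> K * f ((1 + l) * real n0)"
            "K \<ge> (2/3) powr (1/2)"
    and cond2: "\<And>n1. N1 \<le> n1 \<Longrightarrow>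
               c1 * (\<xi>1 t * \<nu>1 n1 / f (real n1) powr (t + \<delta> * t))
                 \<le> (\<Sum>n\<in>{1..<n1}. 1 / f (real n) powr (t + \<delta> * t)) \<and>
               (\<Sum>n\<in>{1..<n1}. 1 / f (real n) powr (t + \<delta> * t))
                 \<le> c2 * (\<xi>2 t * \<nu>2 n1 / f (real n1) powr (t + \<delta> * t))"
    and cond3: "\<And>n1. N1 \<le> n1 \<Longrightarrow>
               summable (\<lambda>k. 1 / f (real (n1 + k)) powr (2 * t)) \<and>
               d1 * (\<eta>1 t * lam1 n1 / f (real n1) powr (2 * t))
                 \<le> (\<Sum>k. 1 / f (real (n1 + k)) powr (2 * t)) \<and>
               (\<Sum>k. 1 / f (real (n1 + k)) powr (2 * t))
                 \<le> d2 * (\<eta>2 t * lam2 n1 / f (real n1) powr (2 * t))"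
    and cond4: "\<And>n0. N0 \<le> n0 \<Longrightarrow> lam1 n0 \<ge> c_lam_nu * \<nu>2 n0"
    and cond5: "\<And>n0. N0 \<le> n0 \<Longrightarrow> lam2 n0 \<le> inverse d2 * inverse (\<eta>2 t) * f (real n0) powr (2 * t)"
    and cond6: "real M \<ge> max
               (4 powr (1 / (1 - t)) *
                 (c2 * \<xi>2 t / (c_lam_nu * d1 * \<eta>1 t)) powr (2 / (t * (1 - t))))
               ((50 / K powr (t * (2 - t))) powr (2 / (1 - t)))"
    and cond7: "\<And>n0 x. N0 \<le> n0 \<Longrightarrow> x \<in> {real n0 .. real n0 + 9 * (real M)^2} \<Longrightarrow>
               deriv f x \<le> 1 / 4752 * (1 / (real M)^4) * f (real n0)"
    and cond8: "\<And>n0. N0 \<le> n0 \<Longrightarrow>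
               f (real n0 + 9 * (real M)^2) \<le> (264 * (real M)^2) powr (1 / t) * f (real n0)"
    and cond9: "\<And>n0. N0 \<le> n0 \<Longrightarrow> 9 * real M * f (real n0) powr t \<le> l * real n0"
    and cond10: "\<And>n0. N0 \<le> n0 \<Longrightarrow>
               \<nu>1 n0 * lam2 n0 powr (- ((1 + \<delta>) / 2))
                 \<ge> (d2 * \<eta>2 t) powr ((1 + \<delta>) / 2) / (c1 * \<xi>1 t) * real M powr (1 - \<delta> / 2)"
  shows "\<forall>n0\<ge>N0. \<exists>\<Omega> a. planar_square a \<Omega> \<and>
           measure lebesgue \<Omega> = (\<Sum>k. f (real (n0 + k)) powr (- 2 * t)) \<and>
           squares_pack_perfectly (\<lambda>n. f (real n) powr (- t)) n0 \<Omega>"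
proof -
  define s where "s n = f (real n) powr (- t)" for n :: nat
  have f_pos': "0 < f (real n)" if "1 \<le> n" for n :: nat using that by (intro f_pos) simp
  have f_le: "f x \<le> f y" if "1 \<le> x" "x \<le> y" for x y using f_mono that by (auto simp: mono_on_def)
  have s_pos: "0 < s n" if "1 \<le> n" for n using f_pos'[OF that] by (simp add: s_def)
  have s_powr: "s n powr (1 + \<delta>) = 1 / f (real n) powr (t + \<delta> * t)" for n
    by (simp add: s_def powr_powr algebra_simps powr_minus_divide[symmetric])
  have s_sq: "(s n)\<^sup>2 = 1 / f (real n) powr (2 * t)" if "1 \<le> n" for n
  proof -
    have "(s n)\<^sup>2 = f (real n) powr (- (2 * t))" by (simp add: s_def power2_eq_square powr_add[symmetric])
    then show ?thesis by (simp add: powr_minus_divide)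
  qed
  have \<delta>01: "0 < \<delta>" "\<delta> < 1" using t \<delta> by auto
  \<comment> \<open>Every index from \<open>N0\<close> on thus exceeds 1, where the derivative of
    \<open>f\<close> is two-sided.\<close>
  have N0: "2 \<le> N0" using nat_pos by linarith
  have Mpos: "0 < real M" using nat_pos by simp
  \<comment> \<open>As \<open>f\<close> is increasing, \<open>cond1\<close> forces this; the second
    entry of the maximum in \<open>cond6\<close> is then at least
    \<open>50 powr (2 / \<delta>)\<close>.\<close>
  have K_le_1: "K \<le> 1"
  proof -
    have N: "1 \<le> real N0" using N0 by simp
    have "f (real N0) \<le> f ((1 + l) * real N0)"
      using N const_pos by (intro f_le) (auto simp: algebra_simps)
    then have "f (real N0) * K \<le> f ((1 + l) * real N0) * K" using const_pos by (intro mult_right_mono) auto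
    also have "\<dots> \<le> f (real N0)" using cond1(1)[of N0] by (simp add: mult.commute)
    finally show ?thesis using f_pos[OF N] by simp
  qed
  have K_half: "1 / 2 \<le> K"
  proof -
    have "(1 / 2 :: real) = (1 / 4) powr (1 / 2)" by (simp add: powr_half_sqrt real_sqrt_divide)
    also have "\<dots> \<le> (2 / 3) powr (1 / 2)" by (intro powr_mono2) auto
    finally show ?thesis using cond1(2) by linarith
  qed
  have M_half: "50 \<le> real M powr (\<delta> / 2)"
  proof -
    have "K powr (t * (2 - t)) \<le> 1" using K_le_1 const_pos t by (intro powr_le1) auto
    then have "50 \<le> 50 / K powr (t * (2 - t))" using const_pos by (simp add: field_simps)
    then have "50 powr (2 / \<delta>) \<le> (50 / K powr (t * (2 - t))) powr (2 / \<delta>)"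
      using \<delta>01 by (intro powr_mono2) auto
    also have "\<dots> \<le> real M" using cond6 \<delta> by auto
    finally have "(50 powr (2 / \<delta>)) powr (\<delta> / 2) \<le> real M powr (\<delta> / 2)"
      using \<delta>01 by (intro powr_mono2) auto
    then show ?thesis using \<delta>01 by (simp add: powr_powr)
  qed
  have M_gt_1: "1 < real M"
  proof (rule ccontr)
    assume "\<not> ?thesis"
    then have "real M powr (\<delta> / 2) \<le> 1" using Mpos \<delta>01 by (intro powr_le1) auto
    then show False using M_half by simp
  qed
  \<comment> \<open>By \<open>cond2\<close>, \<open>cond3\<close> and \<open>cond4\<close>, the sum
    of \<open>s i powr (1 + \<delta>)\<close> over \<open>i < n\<close> is at most
    \<open>B * s n powr (\<delta> - 1)\<close> times the tail sum of squares.\<close>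
  define B where "B = c2 * \<xi>2 t / (c_lam_nu * d1 * \<eta>1 t)"
  have pos: "0 < \<xi>1 t" "0 < \<xi>2 t" "0 < \<eta>1 t" "0 < \<eta>2 t" using \<xi>\<eta>_pos[of t] t by auto
  have B_less: "B < real M powr (\<delta> / 2)"
  proof -
    have B: "0 < B" using pos const_pos by (simp add: B_def)
    have "4 powr (1 / \<delta>) * B powr (2 / (t * \<delta>)) \<le> real M" using cond6 \<delta> by (simp add: B_def)
    \<comment> \<open>This exponent turns the power of \<open>B\<close> into \<open>B\<close>
      itself. The remaining factor \<open>4 powr (t / 2)\<close> is at least 1, and strictness comes
      from enlarging the exponent of \<open>M > 1\<close>.\<close>
    then have "(4 powr (1 / \<delta>) * B powr (2 / (t * \<delta>))) powr (t * \<delta> / 2) \<le> real M powr (t * \<delta> / 2)"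
      using \<delta>01 t by (intro powr_mono2) auto
    moreover have "(4 powr (1 / \<delta>) * B powr (2 / (t * \<delta>))) powr (t * \<delta> / 2) = 4 powr (t / 2) * B"
    proof -
      have "1 / \<delta> * (t * \<delta> / 2) = t / 2" "2 / (t * \<delta>) * (t * \<delta> / 2) = 1" using \<delta>01 t by auto
      moreover have "(4 powr (1 / \<delta>) * B powr (2 / (t * \<delta>))) powr (t * \<delta> / 2)
          = 4 powr (1 / \<delta> * (t * \<delta> / 2)) * B powr (2 / (t * \<delta>) * (t * \<delta> / 2))"
        by (simp only: powr_mult powr_ge_zero powr_powr)
      ultimately show ?thesis using B by simp
    qed
    moreover have "1 * B \<le> 4 powr (t / 2) * B"
      using B t by (intro mult_right_mono ge_one_powr_ge_zero) auto
    moreover have "real M powr (t * \<delta> / 2) < real M powr (\<delta> / 2)"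
      using M_gt_1 t \<delta>01 by (intro powr_less_mono) auto
    ultimately show ?thesis by linarith
  qed
  have tail: "(\<Sum>k. (s (n + k))\<^sup>2) = (\<Sum>k. 1 / f (real (n + k)) powr (2 * t))" if "1 \<le> n" for n
    using that by (intro suminf_cong s_sq) auto
  have tail_bounds: "d1 * (\<eta>1 t * lam1 n) * (s n)\<^sup>2 \<le> (\<Sum>k. (s (n + k))\<^sup>2)"
    "(\<Sum>k. (s (n + k))\<^sup>2) \<le> d2 * \<eta>2 t * lam2 n * (s n)\<^sup>2" if "N0 \<le> n" for n
    using cond3[of n] that nat_pos by (simp_all add: tail s_sq)
  have S_bounds: "c1 * (\<xi>1 t * \<nu>1 n) * s n powr (1 + \<delta>) \<le> (\<Sum>i\<in>{1..<n}. s i powr (1 + \<delta>))"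
    "(\<Sum>i\<in>{1..<n}. s i powr (1 + \<delta>)) \<le> c2 * (\<xi>2 t * \<nu>2 n) * s n powr (1 + \<delta>)" if "N0 \<le> n" for n
    using cond2[of n] that nat_pos by (simp_all add: s_powr)
  interpret packable s M N0 \<delta>
  proof
    show "0 < M" "0 < N0" "0 < \<delta>" "\<delta> < 1" by fact+
    show "0 < s n" if "1 \<le> n" for n using that by (rule s_pos)
    show "s n \<le> s m" if "1 \<le> m" "m \<le> n" for m n
      unfolding s_def using that t f_pos'[of m] f_le[of "real m" "real n"] by (intro powr_mono2') auto
    show "50 \<le> real M powr (\<delta> / 2)" by (rule M_half)
    show "s n - s (n + k) \<le> real k * s n / (4752 * real M ^ 4)" if n: "N0 \<le> n" and k: "k \<le> 9 * M\<^sup>2" for n k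
    proof (cases "k = 0")
      case False
      have n1: "1 < real n" using n N0 by simp
      have k': "real k \<le> 9 * (real M)\<^sup>2" using k by (metis of_nat_le_iff of_nat_mult of_nat_numeral of_nat_power)
      obtain z where z: "real n < z" "z < real (n + k)"
        "f (real (n + k)) - f (real n) = (real (n + k) - real n) * deriv f z"
        using MVT2[of "real n" "real (n + k)" f "deriv f"] False n1 smooth_on_DERIV[OF f_smooth] by auto
      have "deriv f z \<le> 1 / 4752 * (1 / (real M)^4) * f (real n)"
        using z k' by (intro cond7[OF n]) auto
      then have "real k * deriv f z \<le> real k * (1 / 4752 * (1 / (real M)^4) * f (real n))"
        by (intro mult_left_mono) auto
      then have "f (real (n + k)) \<le> f (real n) * (1 + real k / (4752 * real M ^ 4))"
        using z(3) by (simp add: algebra_simps)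
      then have "s n - s (n + k) \<le> real k / (4752 * real M ^ 4) * s n"
        unfolding s_def using n1 t f_pos'[of n] f_pos'[of "n + k"] by (intro powr_minus_close) auto
      then show ?thesis by simp
    qed simp
    \<comment> \<open>\<open>cond9\<close> turns the bound on \<open>m - n\<close> into
      \<open>m \<le> (1 + l) * n\<close>, and \<open>cond1\<close> then compares the values of
      \<open>f\<close>; the factor 2 arises from \<open>K \<ge> 1 / 2\<close>.\<close>
    show "s n \<le> 2 * s m" if n: "N0 \<le> n" "n \<le> m" and m: "real (m - n) * s n \<le> 9 * real M" for n m
    proof -
      have n1: "1 \<le> n" using n N0 by simp
      have "s n * f (real n) powr t = 1" using f_pos'[OF n1] by (simp add: s_def powr_minus)
      then have "real (m - n) = real (m - n) * s n * f (real n) powr t" by simp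
      also have "\<dots> \<le> 9 * real M * f (real n) powr t" using m by (intro mult_right_mono) auto
      also have "\<dots> \<le> l * real n" by (rule cond9[OF n(1)])
      finally have "real m \<le> (1 + l) * real n" using n(2) by (simp add: of_nat_diff algebra_simps)
      then have "f (real m) \<le> f ((1 + l) * real n)" using n n1 by (intro f_le) auto
      then have "K * f (real m) \<le> K * f ((1 + l) * real n)" using const_pos by (intro mult_left_mono) auto
      also have "\<dots> \<le> f (real n)" using cond1(1)[OF n(1)] .
      finally have "f (real n) powr (- t) \<le> (K * f (real m)) powr (- t)"
        using const_pos f_pos'[of m] n n1 t by (intro powr_mono2') auto
      also have "\<dots> = K powr (- t) * s m" using const_pos f_pos'[of m] n n1 by (simp add: s_def powr_mult)
      also have "K powr (- t) \<le> (1 / 2) powr (- t)" using K_half t by (intro powr_mono2') auto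
      also have "(1 / 2 :: real) powr (- t) = 2 powr t" by (simp add: powr_minus powr_divide)
      also have "2 powr t \<le> (2::real) powr 1" using t by (intro powr_mono) auto
      finally show ?thesis using s_pos[of m] n n1 by (simp add: s_def mult_right_mono)
    qed
    show "summable (\<lambda>n. (s n)\<^sup>2)"
    proof -
      have "summable (\<lambda>k. 1 / f (real (N0 + k)) powr (2 * t))" using cond3[of N0] nat_pos by simp
      then have "summable (\<lambda>k. (s (k + N0))\<^sup>2)" using N0 by (simp add: s_sq add.commute)
      then show ?thesis using summable_iff_shift[of "\<lambda>n. (s n)\<^sup>2" N0] by blast
    qed
    show "(\<Sum>k. (s (n + k))\<^sup>2) \<le> 1" if n: "N0 \<le> n" for n
    proof -
      have n1: "1 \<le> n" using n N0 by simp
      have "d2 * \<eta>2 t * lam2 n \<le> f (real n) powr (2 * t)"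
        using cond5[OF n] const_pos pos by (simp add: field_simps)
      then have "d2 * \<eta>2 t * lam2 n * (s n)\<^sup>2 \<le> f (real n) powr (2 * t) * (s n)\<^sup>2"
        by (intro mult_right_mono) auto
      also have "\<dots> = 1" using f_pos'[OF n1] n1 by (simp add: s_sq)
      finally show ?thesis using tail_bounds(2)[OF n] by linarith
    qed
    show "(\<Sum>k. (s (n + k))\<^sup>2) powr ((1 + \<delta>) / 2)
        \<le> real M powr (\<delta> / 2 - 1) * (\<Sum>i\<in>{1..<n}. s i powr (1 + \<delta>))" if n: "N0 \<le> n" for n
    proof -
      let ?e = "(1 + \<delta>) / 2"
      have n1: "1 \<le> n" using n N0 by simp
      have lam: "0 < lam2 n" using seq_pos[OF n1] by simp
      have sn: "0 < s n" by (rule s_pos[OF n1])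
      have tail_nonneg: "0 \<le> (\<Sum>k. (s (n + k))\<^sup>2)"
      proof -
        have "0 < lam1 n" using seq_pos[OF n1] by simp
        then have "0 \<le> d1 * (\<eta>1 t * lam1 n) * (s n)\<^sup>2" using const_pos pos by simp
        then show ?thesis using tail_bounds(1)[OF n] by linarith
      qed
      have "(\<Sum>k. (s (n + k))\<^sup>2) powr ?e \<le> (d2 * \<eta>2 t * lam2 n * (s n)\<^sup>2) powr ?e"
        using tail_nonneg tail_bounds(2)[OF n] \<delta>01 by (intro powr_mono2) auto
      also have "\<dots> = (d2 * \<eta>2 t) powr ?e * lam2 n powr ?e * s n powr (1 + \<delta>)"
      proof -
        have "((s n)\<^sup>2) powr ?e = s n powr (1 + \<delta>)"
        proof -
          have "s n powr 2 = (s n)\<^sup>2" "2 * ?e = 1 + \<delta>" using sn by auto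
          then show ?thesis using powr_powr[of "s n" 2 ?e] by metis
        qed
        then show ?thesis using const_pos pos lam by (simp add: powr_mult)
      qed
      also have "(d2 * \<eta>2 t) powr ?e * lam2 n powr ?e \<le> real M powr (\<delta> / 2 - 1) * (c1 * (\<xi>1 t * \<nu>1 n))"
      proof -
        let ?D = "(d2 * \<eta>2 t) powr ?e" and ?m = "real M powr (1 - \<delta> / 2)" and ?L = "lam2 n powr ?e"
        have L: "0 < ?L" "lam2 n powr (- ?e) = 1 / ?L" using lam by (auto simp: powr_minus_divide)
        have m: "0 < ?m" "real M powr (\<delta> / 2 - 1) = 1 / ?m"
          using Mpos powr_minus_divide[of "real M" "1 - \<delta> / 2"] by auto
        have "?D / (c1 * \<xi>1 t) * ?m \<le> \<nu>1 n * (1 / ?L)" using cond10[OF n] unfolding L(2) .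
        then have "(?D / (c1 * \<xi>1 t) * ?m) * (?L * (c1 * \<xi>1 t) / ?m) \<le> (\<nu>1 n * (1 / ?L)) * (?L * (c1 * \<xi>1 t) / ?m)"
          using L(1) m(1) const_pos pos by (intro mult_right_mono) auto
        moreover have "(?D / (c1 * \<xi>1 t) * ?m) * (?L * (c1 * \<xi>1 t) / ?m) = ?D * ?L"
          using m(1) const_pos pos by simp
        moreover have "(\<nu>1 n * (1 / ?L)) * (?L * (c1 * \<xi>1 t) / ?m) = 1 / ?m * (c1 * (\<xi>1 t * \<nu>1 n))"
          using L(1) by simp
        ultimately show ?thesis unfolding m(2) by linarith
      qed
      finally have "(\<Sum>k. (s (n + k))\<^sup>2) powr ?e
          \<le> real M powr (\<delta> / 2 - 1) * (c1 * (\<xi>1 t * \<nu>1 n)) * s n powr (1 + \<delta>)"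
        by (simp add: mult_right_mono)
      also have "\<dots> = real M powr (\<delta> / 2 - 1) * (c1 * (\<xi>1 t * \<nu>1 n) * s n powr (1 + \<delta>))" by simp
      also have "\<dots> \<le> real M powr (\<delta> / 2 - 1) * (\<Sum>i\<in>{1..<n}. s i powr (1 + \<delta>))"
        using S_bounds(1)[OF n] by (intro mult_left_mono) auto
      finally show ?thesis .
    qed
    show "(real M * s n) powr (1 - \<delta>) * (real M powr (\<delta> / 2 - 1) * (\<Sum>i\<in>{1..<n}. s i powr (1 + \<delta>)))
        < (\<Sum>k. (s (n + k))\<^sup>2)" if n: "N0 \<le> n" for n
    proof -
      have n1: "1 \<le> n" using n N0 by simp
      have \<nu>: "0 < \<nu>2 n" using seq_pos[OF n1] by simp
      have sn: "0 < s n" by (rule s_pos[OF n1])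
      have "(real M * s n) powr (1 - \<delta>) * (real M powr (\<delta> / 2 - 1) * (\<Sum>i\<in>{1..<n}. s i powr (1 + \<delta>)))
        \<le> (real M * s n) powr (1 - \<delta>) * (real M powr (\<delta> / 2 - 1) * (c2 * (\<xi>2 t * \<nu>2 n) * s n powr (1 + \<delta>)))"
        using S_bounds(2)[OF n] by (intro mult_left_mono) auto
      \<comment> \<open>The powers of \<open>M\<close> combine to exponent -\<delta> / 2 and those
        of \<open>s n\<close> to a square, so the claim comes down to \<open>B_less\<close>.\<close>
      also have "\<dots> = (real M powr (1 - \<delta>) * real M powr (\<delta> / 2 - 1)) * (s n powr (1 - \<delta>) * s n powr (1 + \<delta>)) * (c2 * (\<xi>2 t * \<nu>2 n))"
        using sn Mpos by (simp add: powr_mult)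
      also have "real M powr (1 - \<delta>) * real M powr (\<delta> / 2 - 1) = 1 / real M powr (\<delta> / 2)"
        using Mpos powr_minus_divide[of "real M" "\<delta> / 2"] by (simp add: powr_add[symmetric])
      also have "s n powr (1 - \<delta>) * s n powr (1 + \<delta>) = (s n)\<^sup>2"
        using sn by (simp add: powr_add[symmetric] powr_numeral)
      also have "1 / real M powr (\<delta> / 2) * (s n)\<^sup>2 * (c2 * (\<xi>2 t * \<nu>2 n))
          = (c2 * \<xi>2 t / real M powr (\<delta> / 2)) * (\<nu>2 n * (s n)\<^sup>2)" by simp
      also have "\<dots> < (c_lam_nu * d1 * \<eta>1 t) * (\<nu>2 n * (s n)\<^sup>2)"
      proof (intro mult_strict_right_mono)
        show "c2 * \<xi>2 t / real M powr (\<delta> / 2) < c_lam_nu * d1 * \<eta>1 t"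
          using B_less const_pos pos Mpos by (simp add: B_def field_simps)
      qed (use \<nu> sn in simp)
      also have "\<dots> = d1 * (\<eta>1 t * (c_lam_nu * \<nu>2 n)) * (s n)\<^sup>2" by simp
      also have "\<dots> \<le> d1 * (\<eta>1 t * lam1 n) * (s n)\<^sup>2"
        using cond4[OF n] const_pos pos by (intro mult_right_mono mult_left_mono) auto
      also have "\<dots> \<le> (\<Sum>k. (s (n + k))\<^sup>2)" by (rule tail_bounds(1)[OF n])
      finally show ?thesis .
    qed
  qed
  show ?thesis
  proof (intro allI impI)
    fix n0 assume n0: "N0 \<le> n0"
    define a where "a = sqrt (tail n0)"
    have n1: "1 \<le> n0" using n0 N0 by simp
    have a: "0 < a" "a * a = tail n0" using tail_pos[OF n1] by (auto simp: a_def)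
    have "measure lebesgue (rset (sq (0, 0) a)) = tail n0"
      using a by (subst measure_rset) (auto simp: sq_def)
    also have "\<dots> = (\<Sum>k. f (real (n0 + k)) powr (- 2 * t))"
      unfolding tail_def using tail[OF n1] by (simp add: powr_minus_divide)
    finally have "measure lebesgue (rset (sq (0, 0) a)) = (\<Sum>k. f (real (n0 + k)) powr (- 2 * t))" .
    moreover have "squares_pack_perfectly (\<lambda>n. f (real n) powr (- t)) n0 (rset (sq (0, 0) a))"
      using squares_pack_perfectly_into_square[OF n0] by (simp add: a_def s_def[abs_def])
    ultimately show "\<exists>\<Omega> a. planar_square a \<Omega> \<and>
           measure lebesgue \<Omega> = (\<Sum>k. f (real (n0 + k)) powr (- 2 * t)) \<and>
           squares_pack_perfectly (\<lambda>n. f (real n) powr (- t)) n0 \<Omega>"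
      using planar_square_sq[OF a(1)] by blast
  qed
qed

end
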